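(* Let $T\in\mathbb{B}(\mathcal{H})$ be a bounded linear operator on a complex Hilbert space $\mathcal{H}$ and let $\lambda\in[0,1]$. Then $$\begin{aligned}\omega\big(M_\lambda(T)\big)&\le\frac12\big(\lambda\,\omega(T)+(1-\lambda)\,\omega(T^D)\big)\\&\quad+\frac12\sqrt{\big(\lambda\,\omega(T)-(1-\lambda)\,\omega(T^D)\big)^2+4(\lambda-\lambda^2)\sup_{\theta\in\mathbb{R}}\big\|\mathfrak{Re}(e^{i\theta}T)\,\mathfrak{Re}(e^{i\theta}T^D)\big\|}\\&\le\lambda\,\omega(T)+(1-\lambda)\,\omega(T^D).\end{aligned}$$ In particular, $$\omega(\widehat{T})\le\frac{\omega(T)+\omega(T^D)+\sqrt{\big(\omega(T)-\omega(T^D)\big)^2+4\sup_{\theta\in\mathbb{R}}\big\|\mathfrak{Re}(e^{i\theta}T)\,\mathfrak{Re}(e^{i\theta}T^D)\big\|}}{4}\le\omega(T).$$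
   Context: $\mathbb{B}(\mathcal{H})$ is the algebra of bounded linear operators on the complex Hilbert space $\mathcal{H}$, $\|\cdot\|$ the operator norm, $\mathfrak{Re}(A)=\frac12(A+A^* )$, and $\omega(A)=\sup\{|\langle Ax,x\rangle|:\ x\in\mathcal{H},\ \|x\|=1\}$ is the numerical radius. $T=U|T|$ denotes the canonical polar decomposition: $|T|=(T^*T)^{1/2}$ and $U$ is the unique partial isometry with $T=U|T|$ and $\mathcal{N}(U)=\mathcal{N}(T)$ (null spaces). The Duggal transform of $T$ is $T^D:=|T|U$. For $\lambda\in[0,1]$ the $\lambda$-mean transform of $T$ is $M_\lambda(T):=\lambda T+(1-\lambda)T^D$, and $\widehat{T}:=M_{1/2}(T)=\frac12(T+T^D)$ is the mean transform. *)

theory Defs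
  imports "HOL-Analysis.Analysis"
begin

text \<open>The inner product is linear in its first argument and conjugate-linear in the second.
  \<open>norm_eq_sqrt_cinner\<close> makes the library norm, metric and topology of the type those of the
  inner product, so that completeness and \<open>onorm\<close> have their Hilbert space meaning.\<close>

class complex_inner = real_normed_vector +
  fixes scaleC :: "complex \<Rightarrow> 'a \<Rightarrow> 'a" (infixr "*\<^sub>C" 75)
    and cinner :: "'a \<Rightarrow> 'a \<Rightarrow> complex"
  assumes scaleC_add_right: "c *\<^sub>C (x + y) = c *\<^sub>C x + c *\<^sub>C y"
    and scaleC_add_left: "(c + d) *\<^sub>C x = c *\<^sub>C x + d *\<^sub>C x"
    and scaleC_scaleC: "c *\<^sub>C d *\<^sub>C x = (c * d) *\<^sub>C x"
    and scaleR_scaleC: "r *\<^sub>R x = complex_of_real r *\<^sub>C x"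
    and cinner_commute: "cinner x y = cnj (cinner y x)"
    and cinner_add_left: "cinner (x + y) z = cinner x z + cinner y z"
    and cinner_scaleC_left: "cinner (c *\<^sub>C x) y = c * cinner x y"
    and norm_eq_sqrt_cinner: "norm x = sqrt (Re (cinner x x))"

class chilbert_space = complex_inner + complete_space

instantiation complex :: chilbert_space
begin

definition scaleC_complex :: "complex \<Rightarrow> complex \<Rightarrow> complex" where
  "scaleC_complex c x = c * x"

definition cinner_complex :: "complex \<Rightarrow> complex \<Rightarrow> complex" where
  "cinner_complex x y = x * cnj y"

instance
  by standard
    (auto simp: scaleC_complex_def cinner_complex_def algebra_simps scaleR_conv_of_real
      cmod_def power2_eq_square)

end

definition bounded_clinear :: "('a::complex_inner \<Rightarrow> 'a) \<Rightarrow> bool" where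
  "bounded_clinear A \<longleftrightarrow> bounded_linear A \<and> (\<forall>c x. A (c *\<^sub>C x) = c *\<^sub>C A x)"

definition cadjoint :: "('a::chilbert_space \<Rightarrow> 'a) \<Rightarrow> 'a \<Rightarrow> 'a" where
  "cadjoint A = (THE B. bounded_clinear B \<and> (\<forall>x y. cinner (A x) y = cinner x (B y)))"

definition re_op :: "('a::chilbert_space \<Rightarrow> 'a) \<Rightarrow> 'a \<Rightarrow> 'a" where
  "re_op A = (\<lambda>x. (1/2) *\<^sub>R (A x + cadjoint A x))"

text \<open>The supremum is taken in \<open>[0, \<infinity>)\<close>: the inserted \<open>0\<close> matters only for the zero space,
  which has no unit vectors and where \<open>Sup {}\<close> would be an unspecified real.\<close>

definition numerical_radius :: "('a::chilbert_space \<Rightarrow> 'a) \<Rightarrow> real" where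
  "numerical_radius A = Sup (insert 0 {cmod (cinner (A x) x) | x. norm x = 1})"

definition positive_op :: "('a::chilbert_space \<Rightarrow> 'a) \<Rightarrow> bool" where
  "positive_op P \<longleftrightarrow> bounded_clinear P \<and> (\<forall>x. cinner (P x) x \<in> \<real>\<^sub>\<ge>\<^sub>0)"

definition abs_op :: "('a::chilbert_space \<Rightarrow> 'a) \<Rightarrow> 'a \<Rightarrow> 'a" where
  "abs_op T = (THE P. positive_op P \<and> P \<circ> P = cadjoint T \<circ> T)"

definition null_space :: "('a::complex_inner \<Rightarrow> 'a) \<Rightarrow> 'a set" where
  "null_space A = {x. A x = 0}"

text \<open>A partial isometry is isometric on the orthogonal complement of its null space.\<close>

definition partial_isometry :: "('a::chilbert_space \<Rightarrow> 'a) \<Rightarrow> bool" where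
  "partial_isometry U \<longleftrightarrow> bounded_clinear U \<and>
     (\<forall>x. (\<forall>y\<in>null_space U. cinner x y = 0) \<longrightarrow> norm (U x) = norm x)"

definition polar_isometry :: "('a::chilbert_space \<Rightarrow> 'a) \<Rightarrow> 'a \<Rightarrow> 'a" where
  "polar_isometry T =
     (THE U. partial_isometry U \<and> T = U \<circ> abs_op T \<and> null_space U = null_space T)"

definition duggal :: "('a::chilbert_space \<Rightarrow> 'a) \<Rightarrow> 'a \<Rightarrow> 'a" where
  "duggal T = abs_op T \<circ> polar_isometry T"

definition lambda_mean :: "real \<Rightarrow> ('a::chilbert_space \<Rightarrow> 'a) \<Rightarrow> 'a \<Rightarrow> 'a" where
  "lambda_mean l T = (\<lambda>x. l *\<^sub>R T x + (1 - l) *\<^sub>R duggal T x)"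

definition mean_transform :: "('a::chilbert_space \<Rightarrow> 'a) \<Rightarrow> 'a \<Rightarrow> 'a" where
  "mean_transform T = lambda_mean (1/2) T"

definition rotate_op :: "real \<Rightarrow> ('a::chilbert_space \<Rightarrow> 'a) \<Rightarrow> 'a \<Rightarrow> 'a" where
  "rotate_op \<theta> A = (\<lambda>x. exp (\<i> * complex_of_real \<theta>) *\<^sub>C A x)"

end

theory Submission imports Defs begin

text \<open>For a unit vector \<open>x\<close> rotate \<open>T\<close> so that \<open>\<langle>M x, x\<rangle>\<close> is non-negative, where \<open>M\<close> is the
  \<open>\<lambda>\<close>-mean transform. This number is at most the norm \<open>s\<close> of \<open>A + B\<close>, where \<open>A\<close> and \<open>B\<close> are the
  real parts of the rotated \<open>\<lambda> T\<close> and \<open>(1 - \<lambda>) T\<^sup>D\<close>. If \<open>a\<close>, \<open>b\<close>, \<open>c\<close> bound the norms of \<open>A\<close>, \<open>B\<close>,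
  \<open>A B\<close> and \<open>s > a\<close>, then approximate eigenvectors of \<open>A + B\<close> give \<open>(s - a) (s - b) \<le> c\<close>, and solving
  this quadratic inequality for \<open>s\<close> gives the first estimate. The bound by \<open>\<omega>(T)\<close> at the end
  holds because \<open>T\<^sup>D = U\<^sup>* T U\<close> with \<open>U\<close> a contraction.\<close>

text \<open>The square root iteration below converges in the space of bounded operators, whose
  completeness comes from the class \<open>banach\<close>.\<close>

instance chilbert_space \<subseteq> banach ..

subsection \<open>Complex inner products\<close>

lemma cinner_add_right: "cinner x (y + z) = cinner x y + cinner x z"
  by (metis cinner_add_left cinner_commute complex_cnj_add)

lemma cinner_scaleC_right: "cinner x (c *\<^sub>C y) = cnj c * cinner x y"
  by (metis cinner_commute cinner_scaleC_left complex_cnj_mult)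

lemma cinner_scaleR_left: "cinner (r *\<^sub>R x) y = of_real r * cinner x y"
  by (simp add: scaleR_scaleC cinner_scaleC_left)

lemma cinner_scaleR_right: "cinner x (r *\<^sub>R y) = of_real r * cinner x y"
  by (simp add: scaleR_scaleC cinner_scaleC_right)

lemma cinner_minus_left: "cinner (- x) y = - cinner x y"
  using cinner_scaleR_left[of "-1" x y] by simp

lemma cinner_minus_right: "cinner x (- y) = - cinner x y"
  using cinner_scaleR_right[of x "-1" y] by simp

lemma cinner_diff_left: "cinner (x - y) z = cinner x z - cinner y z"
  using cinner_add_left[of x "- y" z] by (simp add: cinner_minus_left)

lemma cinner_diff_right: "cinner x (y - z) = cinner x y - cinner x z"
  using cinner_add_right[of x y "- z"] by (simp add: cinner_minus_right)

lemma cinner_zero_left [simp]: "cinner 0 x = 0"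
  using cinner_diff_left[of x x x] by simp

lemma cinner_zero_right [simp]: "cinner x 0 = 0"
  using cinner_diff_right[of x x x] by simp

lemmas cinner_simps = cinner_add_left cinner_add_right cinner_diff_left cinner_diff_right
  cinner_minus_left cinner_minus_right cinner_scaleC_left cinner_scaleC_right
  cinner_scaleR_left cinner_scaleR_right

text \<open>The norm axiom fixes only the real part; Hermitian symmetry removes the imaginary
  part.\<close>

lemma cinner_self: "cinner x x = complex_of_real ((norm x)\<^sup>2)"
proof (rule complex_eqI)
  \<comment> \<open>Positivity is read off from \<open>norm x \<ge> 0\<close>, because in HOL
    \<open>sqrt\<close> of a negative real is negative.\<close>
  have "0 \<le> Re (cinner x x)"
    using norm_ge_zero[of x] by (simp add: norm_eq_sqrt_cinner)
  then show "Re (cinner x x) = Re (complex_of_real ((norm x)\<^sup>2))"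
    by (simp add: norm_eq_sqrt_cinner)
  have "Im (cinner x x) = - Im (cinner x x)"
    by (metis cinner_commute cnj.sel(2))
  then show "Im (cinner x x) = Im (complex_of_real ((norm x)\<^sup>2))"
    by simp
qed

lemma power2_norm_eq_cinner: "(norm x)\<^sup>2 = Re (cinner x x)"
  by (simp add: cinner_self)

lemma Re_cinner_commute: "Re (cinner x y) = Re (cinner y x)"
  by (metis cinner_commute cnj.sel(1))

lemma power2_norm_add: "(norm (x + y))\<^sup>2 = (norm x)\<^sup>2 + 2 * Re (cinner x y) + (norm y)\<^sup>2"
  by (simp add: power2_norm_eq_cinner cinner_simps Re_cinner_commute[of y x])

lemma power2_norm_diff: "(norm (x - y))\<^sup>2 = (norm x)\<^sup>2 - 2 * Re (cinner x y) + (norm y)\<^sup>2"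
  by (simp add: power2_norm_eq_cinner cinner_simps Re_cinner_commute[of y x])

section \<open>Complex scalars and the Cauchy-Schwarz inequality\<close>

lemma scaleC_zero_right [simp]: "c *\<^sub>C 0 = 0"
  using scaleC_add_right[of c 0 0] by simp

lemma scaleC_diff_right: "c *\<^sub>C (x - y) = c *\<^sub>C x - c *\<^sub>C y"
  by (metis add_diff_cancel diff_add_cancel scaleC_add_right)

lemma scaleC_scaleR: "c *\<^sub>C r *\<^sub>R x = r *\<^sub>R c *\<^sub>C x"
  by (simp add: scaleR_scaleC scaleC_scaleC mult.commute)

lemma norm_scaleC: "norm (c *\<^sub>C x) = cmod c * norm x"
proof (rule power2_eq_imp_eq)
  have "cinner (c *\<^sub>C x) (c *\<^sub>C x) = c * cnj c * cinner x x"
    by (simp add: cinner_simps)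
  also have "\<dots> = of_real ((cmod c * norm x)\<^sup>2)"
    by (simp add: cinner_self power_mult_distrib flip: complex_norm_square)
  finally have "cinner (c *\<^sub>C x) (c *\<^sub>C x) = of_real ((cmod c * norm x)\<^sup>2)" .
  then show "(norm (c *\<^sub>C x))\<^sup>2 = (cmod c * norm x)\<^sup>2"
    by (simp add: power2_norm_eq_cinner)
qed auto

lemma ex_unimodular: "\<exists>u. cmod u = 1 \<and> u * z = complex_of_real (cmod z)"
proof (cases "z = 0")
  case False
  then show ?thesis
    using complex_norm_square[of z]
    by (intro exI[of _ "cnj z / cmod z"])
       (simp add: norm_divide field_simps power2_eq_square)
qed (auto intro: exI[of _ 1])

text \<open>The triangle inequality is already an axiom of normed spaces, so Cauchy-Schwarz follows
  by squaring it, reversing the usual order.\<close>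

lemma Re_cinner_le: "Re (cinner x y) \<le> norm x * norm y"
proof -
  have "(norm (x + y))\<^sup>2 \<le> (norm x + norm y)\<^sup>2"
    by (intro power_mono norm_triangle_ineq) auto
  then show ?thesis
    by (simp add: power2_norm_add power2_sum)
qed

text \<open>A unimodular factor turns the modulus into a real part without changing the norm of
  \<open>x\<close>.\<close>

lemma cmod_cinner_le: "cmod (cinner x y) \<le> norm x * norm y"
proof -
  obtain u where u: "cmod u = 1" "u * cinner x y = of_real (cmod (cinner x y))"
    using ex_unimodular by blast
  show ?thesis
    using Re_cinner_le[of "u *\<^sub>C x" y] u by (simp add: cinner_simps norm_scaleC)
qed

text \<open>Provides continuity of the inner product in both arguments; bilinearity here is over the
  reals.\<close>

interpretation cinner: bounded_bilinear "cinner :: 'a::complex_inner \<Rightarrow> 'a \<Rightarrow> complex"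
  by standard (auto simp: cinner_simps scaleR_conv_of_real intro!: exI[of _ 1] cmod_cinner_le)

lemma bounded_linear_scaleC: "bounded_linear (\<lambda>x. c *\<^sub>C x :: 'a::complex_inner)"
  by standard (auto simp: scaleC_add_right scaleC_scaleR norm_scaleC intro!: exI[of _ "cmod c"])

lemma cinner_ext: "(\<And>z. cinner x z = cinner y z) \<Longrightarrow> x = y"
  using cinner_self[of "x - y"] by (simp add: cinner_simps)

text \<open>The parallelogram law for \<open>x - a\<close> and \<open>x - b\<close>; it forces
  minimising sequences to be Cauchy.\<close>

lemma power2_norm_midpoint:
  fixes a b x :: "'a::complex_inner"
  shows "(norm (a - b))\<^sup>2 = 2 * (norm (x - a))\<^sup>2 + 2 * (norm (x - b))\<^sup>2 
     - 4 * (norm (x - (1/2) *\<^sub>R (a + b)))\<^sup>2"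
  by (simp add: power2_norm_eq_cinner cinner_simps Re_cinner_commute[of b a] 
      Re_cinner_commute[of a x] Re_cinner_commute[of b x] algebra_simps)

text \<open>The subspace \<open>M\<close> need not be closed: the projection \<open>p\<close> is the limit of a minimising sequence.\<close>

lemma orthogonal_projection:
  fixes M :: "'a::chilbert_space set"
  assumes zero: "0 \<in> M" and add: "\<And>x y. x \<in> M \<Longrightarrow> y \<in> M \<Longrightarrow> x + y \<in> M"
    and scale: "\<And>c x. x \<in> M \<Longrightarrow> c *\<^sub>C x \<in> M"
  obtains X p where "\<And>n. X n \<in> M" "X \<longlonglongrightarrow> p" "\<And>m. m \<in> M \<Longrightarrow> cinner (x - p) m = 0"
proof -
  define d where "d = infdist x M"
  have d: "d \<le> norm (x - m)" if "m \<in> M" for m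
    using infdist_le[OF that] by (simp add: d_def dist_norm)
  have d0: "0 \<le> d" by (simp add: d_def infdist_nonneg)
  have "\<exists>m\<in>M. norm (x - m) < d + inverse (real (Suc n))" for n
  proof -
    have "infdist x M < d + inverse (real (Suc n))" by (simp add: d_def)
    moreover have "infdist x M = (INF m\<in>M. norm (x - m))"
      using zero by (auto simp: infdist_def dist_norm)
    moreover have "bdd_below ((\<lambda>m. norm (x - m)) ` M)"
      using d by (intro bdd_belowI2)
    ultimately show ?thesis
      using zero cINF_less_iff[of M "\<lambda>m. norm (x - m)"] by auto
  qed
  then obtain X where X: "\<And>n. X n \<in> M" "\<And>n. norm (x - X n) < d + inverse (real (Suc n))"
    by metis
  have lim: "(\<lambda>n. norm (x - X n)) \<longlonglongrightarrow> d"
    by (rule real_tendsto_sandwich[where f = "\<lambda>n. d" and h = "\<lambda>n. d + inverse (real (Suc n))"])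
       (use d X LIMSEQ_inverse_real_of_nat_add[of d] in \<open>auto intro!: eventuallyI less_imp_le\<close>)
  have "Cauchy X"
  proof (rule metric_CauchyI)
    fix e :: real assume e: "e > 0"
    have "(\<lambda>n. (norm (x - X n))\<^sup>2) \<longlonglongrightarrow> d\<^sup>2"
      by (intro tendsto_intros lim)
    \<comment> \<open>With the margin \<open>e\<^sup>2 / 4\<close> the midpoint identity gives
      exactly \<open>4 * (d\<^sup>2 + e\<^sup>2 / 4) - 4 * d\<^sup>2 = e\<^sup>2\<close>.\<close>
    then have "\<forall>\<^sub>F n in sequentially. (norm (x - X n))\<^sup>2 < d\<^sup>2 + e\<^sup>2 / 4"
      using e by (intro order_tendstoD) auto
    then obtain N where N: "\<And>n. n \<ge> N \<Longrightarrow> (norm (x - X n))\<^sup>2 < d\<^sup>2 + e\<^sup>2 / 4"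
      by (auto simp: eventually_sequentially)
    have "dist (X m) (X n) < e" if "m \<ge> N" "n \<ge> N" for m n
    proof -
      have "d \<le> norm (x - (1/2) *\<^sub>R (X m + X n))"
        using X by (intro d) (auto simp: scaleR_scaleC intro!: scale add)
      then have "d\<^sup>2 \<le> (norm (x - (1/2) *\<^sub>R (X m + X n)))\<^sup>2"
        using d0 by (intro power_mono)
      then have "(norm (X m - X n))\<^sup>2 < e\<^sup>2"
        using N[OF that(1)] N[OF that(2)] power2_norm_midpoint[of "X m" "X n" x] by linarith
      then show ?thesis
        using e by (simp add: dist_norm power2_less_imp_less)
    qed
    then show "\<exists>N. \<forall>m\<ge>N. \<forall>n\<ge>N. dist (X m) (X n) < e" by blast
  qed
  then obtain p where p: "X \<longlonglongrightarrow> p"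
    unfolding Cauchy_convergent_iff convergent_def by blast
  have "cinner (x - p) m = 0" if m: "m \<in> M" for m
  proof (rule ccontr)
    assume "cinner (x - p) m \<noteq> 0"
    define z where "z = x - p"
    define g where "g = cinner z m"
    have g0: "cmod g > 0" using \<open>cinner (x - p) m \<noteq> 0\<close> by (simp add: g_def z_def)
    have dz: "d = norm z"
      unfolding z_def by (intro LIMSEQ_unique[OF lim] tendsto_intros p)
    \<comment> \<open>Moving \<open>p\<close> by \<open>t * g\<close> times \<open>m\<close> gains
      \<open>2 * t * (cmod g)\<^sup>2\<close> in squared distance to first order, which beats the
      second-order loss once \<open>t * (norm m)\<^sup>2 \<le> 1\<close>. The added 1 keeps the
      denominator positive.\<close>
    define t where "t = inverse ((norm m)\<^sup>2 + 1)"
    define c where "c = of_real t * g"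
    have t0: "t > 0" by (simp add: t_def add_nonneg_pos)
    have tm: "t * (norm m)\<^sup>2 \<le> 1" by (simp add: t_def divide_simps add_nonneg_pos)
    \<comment> \<open>The limit \<open>p\<close> may lie outside \<open>M\<close>, so minimality is
      applied to \<open>X n + c *\<^sub>C m\<close> and passed to the limit.\<close>
    have "(\<lambda>n. norm (x - (X n + c *\<^sub>C m))) \<longlonglongrightarrow> norm (x - (p + c *\<^sub>C m))"
      by (intro tendsto_intros p)
    then have "d \<le> norm (x - (p + c *\<^sub>C m))"
      by (rule LIMSEQ_le_const) (use X m in \<open>blast intro: d add scale\<close>)
    then have "d \<le> norm (z - c *\<^sub>C m)"
      by (simp add: z_def algebra_simps)
    then have "(norm z)\<^sup>2 \<le> (norm (z - c *\<^sub>C m))\<^sup>2"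
      using d0 dz by (intro power_mono) auto
    also have "\<dots> = (norm z)\<^sup>2 - 2 * t * (cmod g)\<^sup>2 + (t * cmod g)\<^sup>2 * (norm m)\<^sup>2"
    proof -
      have "cinner z (c *\<^sub>C m) = of_real (t * (cmod g)\<^sup>2)"
        using complex_norm_square[of g] by (simp add: cinner_simps c_def g_def mult.commute mult.left_commute)
      then show ?thesis
        using t0 by (simp add: power2_norm_diff norm_scaleC c_def norm_mult power_mult_distrib)
    qed
    finally have "2 * (t * (cmod g)\<^sup>2) \<le> (t * (norm m)\<^sup>2) * (t * (cmod g)\<^sup>2)"
      by (simp add: power2_eq_square algebra_simps)
    also have "\<dots> \<le> 1 * (t * (cmod g)\<^sup>2)"
      using tm t0 by (intro mult_right_mono) auto
    finally show False using t0 g0 by auto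
  qed
  then show ?thesis using that X p by blast
qed

subsection \<open>Adjoints\<close>

lemma bounded_clinearD:
  assumes "bounded_clinear A"
  shows "bounded_linear A" "A (c *\<^sub>C x) = c *\<^sub>C A x"
    "A (x + y) = A x + A y" "A (x - y) = A x - A y" "A (r *\<^sub>R x) = r *\<^sub>R A x" "A 0 = 0"
proof -
  show A: "bounded_linear A" and "A (c *\<^sub>C x) = c *\<^sub>C A x"
    using assms unfolding bounded_clinear_def by blast+
  show "A (x + y) = A x + A y" "A (x - y) = A x - A y" "A (r *\<^sub>R x) = r *\<^sub>R A x" "A 0 = 0"
    using A by (simp_all add: linear_simps)
qed

lemma bounded_clinearI:
  assumes "\<And>x y. A (x + y) = A x + A y" "\<And>c x. A (c *\<^sub>C x) = c *\<^sub>C A x"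
    and "\<And>x. norm (A x) \<le> K * norm x"
  shows "bounded_clinear A"
  unfolding bounded_clinear_def
proof
  show "bounded_linear A"
    by (rule bounded_linear_intro[of _ K])
      (simp_all only: assms scaleR_scaleC mult.commute[of _ K])
qed (simp add: assms)

lemma bounded_clinear_bound:
  assumes "bounded_clinear A"
  obtains K where "K \<ge> 0" "\<And>x. norm (A x) \<le> K * norm x"
  using onorm_pos_le[OF bounded_clinearD(1)[OF assms]] onorm[OF bounded_clinearD(1)[OF assms]]
  by (rule that)

lemma bounded_clinear_compose:
  "bounded_clinear A \<Longrightarrow> bounded_clinear B \<Longrightarrow> bounded_clinear (\<lambda>x. A (B x))"
  unfolding bounded_clinear_def using bounded_linear_compose[of A B] by simp

lemma bounded_clinear_add:
  "bounded_clinear A \<Longrightarrow> bounded_clinear B \<Longrightarrow> bounded_clinear (\<lambda>x. A x + B x)"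
  unfolding bounded_clinear_def by (simp add: bounded_linear_add scaleC_add_right)

lemma bounded_clinear_diff:
  "bounded_clinear A \<Longrightarrow> bounded_clinear B \<Longrightarrow> bounded_clinear (\<lambda>x. A x - B x)"
  unfolding bounded_clinear_def by (simp add: bounded_linear_sub scaleC_diff_right)

lemma bounded_clinear_scaleR:
  "bounded_clinear A \<Longrightarrow> bounded_clinear (\<lambda>x. r *\<^sub>R A x)"
  unfolding bounded_clinear_def
  by (simp add: bounded_linear_const_scaleR scaleC_scaleR)

lemma bounded_clinear_scaleC:
  "bounded_clinear A \<Longrightarrow> bounded_clinear (\<lambda>x. c *\<^sub>C A x)"
  unfolding bounded_clinear_def
  using bounded_linear_compose[OF bounded_linear_scaleC, of A c]
  by (simp add: scaleC_scaleC mult.commute)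

lemma bounded_clinear_ident: "bounded_clinear (\<lambda>x. x)"
  unfolding bounded_clinear_def by auto

text \<open>Projecting onto the kernel yields \<open>z\<close> orthogonal to it. Since
  \<open>f z *\<^sub>C x - f x *\<^sub>C z\<close> lies in the kernel, pairing it with
  \<open>z\<close> expresses \<open>f x\<close> through \<open>cinner x z\<close>.\<close>

lemma riesz_representation:
  fixes f :: "'a::chilbert_space \<Rightarrow> complex"
  assumes f: "bounded_linear f" and hom: "\<And>c x. f (c *\<^sub>C x) = c * f x"
  obtains y where "\<And>x. f x = cinner x y"
proof (cases "\<forall>x. f x = 0")
  case True
  then show ?thesis using that[of 0] by auto
next
  case False
  then obtain a where a: "f a \<noteq> 0" by blast
  interpret f: bounded_linear f by fact
  obtain X p where X: "\<And>n. f (X n) = 0" "X \<longlonglongrightarrow> p" "\<And>m. f m = 0 \<Longrightarrow> cinner (a - p) m = 0"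
    using orthogonal_projection[of "{x. f x = 0}" a]
    by (auto simp: f.add f.zero hom)
  \<comment> \<open>The kernel is closed by continuity of \<open>f\<close>, hence contains the limit
    \<open>p\<close>; this makes \<open>f z = f a\<close> nonzero.\<close>
  have "f p = 0"
    using LIMSEQ_unique[OF f.tendsto[OF X(2)]] X(1) by simp
  define z where "z = a - p"
  have fz: "f z \<noteq> 0" using a \<open>f p = 0\<close> by (simp add: z_def f.diff)
  then have z0: "z \<noteq> 0" using f.zero by auto
  show ?thesis
  proof
    fix x
    have "f (f z *\<^sub>C x - f x *\<^sub>C z) = 0" by (simp add: f.diff hom)
    then have "cinner z (f z *\<^sub>C x - f x *\<^sub>C z) = 0" using X(3) by (simp add: z_def)
    then have "cinner (f z *\<^sub>C x - f x *\<^sub>C z) z = 0"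
      by (metis cinner_commute complex_cnj_zero)
    then have "f z * cinner x z = f x * cinner z z" by (simp add: cinner_simps)
    then show "f x = cinner x (cnj (f z / cinner z z) *\<^sub>C z)"
      using z0 by (simp add: cinner_simps field_simps cinner_self)
  qed
qed

text \<open>Riesz gives \<open>B y\<close> for each \<open>y\<close>. Testing against all vectors
  makes \<open>B\<close> linear, and \<open>cinner (A (B y)) y = (norm (B y))\<^sup>2\<close>
  transfers the bound of \<open>A\<close> to \<open>B\<close>.\<close>

lemma cadjoint_exists:
  fixes A :: "'a::chilbert_space \<Rightarrow> 'a"
  assumes A: "bounded_clinear A"
  shows "\<exists>B. bounded_clinear B \<and> (\<forall>x y. cinner (A x) y = cinner x (B y))"
proof -
  have "\<exists>b. \<forall>x. cinner (A x) y = cinner x b" for y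
  proof -
    have "bounded_linear (\<lambda>x. cinner (A x) y)"
      by (rule bounded_linear_compose[OF cinner.bounded_linear_left]) (rule bounded_clinearD[OF A])
    then show ?thesis
      by (rule riesz_representation) (auto simp: bounded_clinearD[OF A] cinner_simps)
  qed
  then obtain B where B: "\<And>x y. cinner (A x) y = cinner x (B y)" by metis
  then have B': "\<And>x y. cinner (B y) x = cinner y (A x)" by (metis cinner_commute)
  obtain K where K: "K \<ge> 0" "\<And>x. norm (A x) \<le> K * norm x"
    using bounded_clinear_bound[OF A] by blast
  have "norm (B x) \<le> K * norm x" for x
  proof (cases "B x = 0")
    case False
    have "norm (B x) * norm (B x) = cmod (cinner (A (B x)) x)"
      by (simp add: B cinner_self norm_mult power2_eq_square)
    also have "\<dots> \<le> norm (A (B x)) * norm x" by (rule cmod_cinner_le)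
    also have "\<dots> \<le> (K * norm (B x)) * norm x" by (intro mult_right_mono K) auto
    finally show ?thesis using False by (simp add: mult.assoc mult.left_commute)
  qed (use K in auto)
  moreover have "B (x + y) = B x + B y" "B (c *\<^sub>C x) = c *\<^sub>C B x" for x y c
    by (rule cinner_ext, simp add: B' cinner_simps)+
  ultimately have "bounded_clinear B"
    by (intro bounded_clinearI[of _ K])
  then show ?thesis using B by blast
qed

lemma
  fixes A :: "'a::chilbert_space \<Rightarrow> 'a"
  assumes A: "bounded_clinear A"
  shows bounded_clinear_cadjoint: "bounded_clinear (cadjoint A)"
    and cadjoint_right: "cinner (A x) y = cinner x (cadjoint A y)"
    and cadjoint_left: "cinner (cadjoint A x) y = cinner x (A y)"
proof -
  let ?P = "\<lambda>B. bounded_clinear B \<and> (\<forall>x y. cinner (A x) y = cinner x (B y))"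
  have "\<exists>!B. ?P B"
  proof (rule ex_ex1I[OF cadjoint_exists[OF A]])
    fix B C assume "?P B" "?P C"
    then have "cinner (B x) y = cinner (C x) y" for x y by (metis cinner_commute)
    then have "B x = C x" for x by (rule cinner_ext)
    then show "B = C" ..
  qed
  then have *: "?P (cadjoint A)"
    unfolding cadjoint_def by (rule theI')
  then show "bounded_clinear (cadjoint A)" "cinner (A x) y = cinner x (cadjoint A y)"
    by blast+
  show "cinner (cadjoint A x) y = cinner x (A y)"
    using * by (subst cinner_commute, subst (2) cinner_commute) simp
qed

subsection \<open>Symmetric operators and the numerical radius\<close>

text \<open>Self-adjointness as an identity of inner products, a form that passes to sums and limits
  without mention of adjoints.\<close>

definition symmetric_op :: "('a::complex_inner \<Rightarrow> 'a) \<Rightarrow> bool" where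
  "symmetric_op A \<longleftrightarrow> bounded_clinear A \<and> (\<forall>x y. cinner (A x) y = cinner x (A y))"

lemma symmetric_opD:
  assumes "symmetric_op A"
  shows "bounded_clinear A" "cinner (A x) y = cinner x (A y)"
  using assms by (auto simp: symmetric_op_def)

lemma symmetric_op_cinner_real:
  assumes "symmetric_op A"
  shows "cinner (A x) x = complex_of_real (Re (cinner (A x) x))"
proof -
  have "cinner (A x) x = cnj (cinner (A x) x)"
    by (metis assms cinner_commute symmetric_opD(2))
  then show ?thesis by (simp add: complex_eq_iff)
qed

section \<open>Numerical radius and norm\<close>

lemma bdd_above_numerical_range:
  fixes A :: "'a::chilbert_space \<Rightarrow> 'a"
  assumes "bounded_clinear A"
  shows "bdd_above (insert 0 {cmod (cinner (A x) x) | x. norm x = 1})"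
proof -
  obtain K where K: "K \<ge> 0" "\<And>x. norm (A x) \<le> K * norm x"
    using bounded_clinear_bound[OF assms] by blast
  have "cmod (cinner (A x) x) \<le> K" if "norm x = 1" for x
    using cmod_cinner_le[of "A x" x] K(2)[of x] that by simp
  then show ?thesis using K by (auto intro!: bdd_aboveI[of _ K])
qed

lemma numerical_radius_nonneg:
  fixes A :: "'a::chilbert_space \<Rightarrow> 'a"
  assumes "bounded_clinear A"
  shows "0 \<le> numerical_radius A"
  unfolding numerical_radius_def by (intro cSup_upper bdd_above_numerical_range assms) auto

lemma cmod_cinner_le_numerical_radius:
  fixes A :: "'a::chilbert_space \<Rightarrow> 'a"
  assumes A: "bounded_clinear A"
  shows "cmod (cinner (A x) x) \<le> numerical_radius A * (norm x)\<^sup>2"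
proof (cases "x = 0")
  case False
  define y where "y = (1 / norm x) *\<^sub>R x"
  have "norm y = 1" using False by (simp add: y_def)
  then have "cmod (cinner (A y) y) \<le> numerical_radius A"
    unfolding numerical_radius_def by (intro cSup_upper bdd_above_numerical_range A) auto
  moreover have "cmod (cinner (A y) y) = cmod (cinner (A x) x) / (norm x)\<^sup>2"
    by (simp add: y_def bounded_clinearD[OF A] cinner_simps norm_mult norm_divide power2_eq_square)
  ultimately show ?thesis using False by (simp add: field_simps)
qed auto

lemma numerical_radius_le:
  assumes "0 \<le> w" "\<And>x. norm x = 1 \<Longrightarrow> cmod (cinner (A x) x) \<le> w"
  shows "numerical_radius A \<le> w"
  unfolding numerical_radius_def using assms by (intro cSup_least) auto

text \<open>Polarisation writes \<open>4 * Re (cinner (A x) y)\<close> as a difference of values of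
  the quadratic form at \<open>x + y\<close> and \<open>x - y\<close>; the parallelogram law then
  bounds it.\<close>

lemma symmetric_op_norm_le:
  fixes A :: "'a::chilbert_space \<Rightarrow> 'a"
  assumes A: "symmetric_op A" and w: "\<And>x. \<bar>Re (cinner (A x) x)\<bar> \<le> w * (norm x)\<^sup>2"
  shows "norm (A x) \<le> w * norm x"
proof (cases "A x = 0 \<or> x = 0")
  case False
  note lin = bounded_clinearD[OF symmetric_opD(1)[OF A]]
  \<comment> \<open>Parallel to \<open>A x\<close>, so that the inner product attains
    \<open>norm x * norm (A x)\<close>, and of the same norm as \<open>x\<close>.\<close>
  define y where "y = (norm x / norm (A x)) *\<^sub>R A x"
  have ny: "norm y = norm x" using False by (simp add: y_def)
  have "cinner (A x) y = of_real (norm x * norm (A x))"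
    using False by (simp add: y_def cinner_simps cinner_self power2_eq_square)
  then have "4 * (norm x * norm (A x)) = 4 * Re (cinner (A x) y)" by simp
  also have "\<dots> = Re (cinner (A (x + y)) (x + y)) - Re (cinner (A (x - y)) (x - y))"
    using Re_cinner_commute[of "A y" x] symmetric_opD(2)[OF A, of x y]
    by (simp add: lin cinner_simps)
  also have "\<dots> \<le> w * (norm (x + y))\<^sup>2 + w * (norm (x - y))\<^sup>2"
    using w[of "x + y"] w[of "x - y"] by linarith
  also have "\<dots> = w * (4 * (norm x)\<^sup>2)"
    by (simp add: power2_norm_add power2_norm_diff ny algebra_simps)
  finally show ?thesis using False by (simp add: power2_eq_square)
next
  case True
  \<comment> \<open>The sign of \<open>w\<close> is not assumed; the form bound at a nonzero
    \<open>x\<close> supplies it.\<close>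
  have "0 \<le> w * norm x"
  proof (cases "x = 0")
    case False
    have "0 \<le> w * (norm x)\<^sup>2" using w[of x] by linarith
    then show ?thesis using False by (simp add: zero_le_mult_iff)
  qed auto
  then show ?thesis using True bounded_clinearD(6)[OF symmetric_opD(1)[OF A]] by auto
qed

lemma norm_le_numerical_radius:
  fixes A :: "'a::chilbert_space \<Rightarrow> 'a"
  assumes "symmetric_op A"
  shows "norm (A x) \<le> numerical_radius A * norm x"
  by (rule symmetric_op_norm_le[OF assms])
     (meson abs_Re_le_cmod assms cmod_cinner_le_numerical_radius order_trans symmetric_opD(1))

text \<open>For unit vectors nearly attaining the supremum \<open>s\<close>, expanding the square
  gives \<open>(norm (A x))\<^sup>2 - \<mu>\<^sup>2 \<le> s\<^sup>2 - \<mu>\<^sup>2\<close>, which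
  tends to 0.\<close>

lemma approximate_eigenvector:
  fixes A :: "'a::chilbert_space \<Rightarrow> 'a"
  assumes A: "symmetric_op A" and pos: "0 < numerical_radius A"
  obtains x \<mu> where "\<And>n. norm (x n) = 1" "\<And>n. \<mu> n = Re (cinner (A (x n)) (x n))"
    "(\<lambda>n. \<bar>\<mu> n\<bar>) \<longlonglongrightarrow> numerical_radius A" "(\<lambda>n. norm (A (x n) - \<mu> n *\<^sub>R x n)) \<longlonglongrightarrow> 0"
proof -
  define s where "s = numerical_radius A"
  \<comment> \<open>The index \<open>Suc (Suc n)\<close> keeps the threshold positive, so the
    element found above it comes from a unit vector and is not the inserted
    \<open>0\<close>.\<close>
  have "\<exists>x. norm x = 1 \<and> s - s * inverse (real (Suc (Suc n))) < \<bar>Re (cinner (A x) x)\<bar>" for n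
  proof -
    have i: "inverse (real (Suc (Suc n))) < 1" by (simp add: field_simps)
    have "s - s * inverse (real (Suc (Suc n))) < s" using pos by (simp add: s_def)
    moreover have "0 < s - s * inverse (real (Suc (Suc n)))"
      using mult_strict_left_mono[OF i, of s] pos by (simp add: s_def)
    ultimately show ?thesis
      using less_cSupD[of "insert 0 {cmod (cinner (A x) x) | x. norm x = 1}"]
        symmetric_op_cinner_real[OF A]
      unfolding s_def numerical_radius_def by (smt (verit) insert_iff insert_not_empty mem_Collect_eq norm_of_real)
  qed
  then obtain x where x: "\<And>n. norm (x n) = 1"
    "\<And>n. s - s * inverse (real (Suc (Suc n))) < \<bar>Re (cinner (A (x n)) (x n))\<bar>" by metis
  define \<mu> where "\<mu> = (\<lambda>n. Re (cinner (A (x n)) (x n)))"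
  have le: "\<bar>\<mu> n\<bar> \<le> s" for n
    using cmod_cinner_le_numerical_radius[OF symmetric_opD(1)[OF A], of "x n"] x(1)[of n]
      abs_Re_le_cmod[of "cinner (A (x n)) (x n)"] by (simp add: \<mu>_def s_def)
  have lim: "(\<lambda>n. \<bar>\<mu> n\<bar>) \<longlonglongrightarrow> s"
  proof (rule real_tendsto_sandwich[where h = "\<lambda>_. s"])
    have "(\<lambda>n. s - s * inverse (real (Suc (Suc n)))) \<longlonglongrightarrow> s - s * 0"
      by (intro tendsto_intros LIMSEQ_Suc[OF LIMSEQ_inverse_real_of_nat])
    then show "(\<lambda>n. s - s * inverse (real (Suc (Suc n)))) \<longlonglongrightarrow> s" by simp
  qed (use less_imp_le[OF x(2)] le in \<open>auto simp: \<mu>_def\<close>)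
  have "(norm (A (x n) - \<mu> n *\<^sub>R x n))\<^sup>2 \<le> s\<^sup>2 - \<bar>\<mu> n\<bar>\<^sup>2" for n
  proof -
    have "(norm (A (x n)))\<^sup>2 \<le> s\<^sup>2"
      using norm_le_numerical_radius[OF A, of "x n"] x(1)[of n] by (intro power_mono) (auto simp: s_def)
    then show ?thesis
      by (simp add: power2_norm_diff x(1) \<mu>_def cinner_simps power_mult_distrib)
         (simp add: power2_eq_square)
  qed
  moreover have "(\<lambda>n. s\<^sup>2 - \<bar>\<mu> n\<bar>\<^sup>2) \<longlonglongrightarrow> 0"
    using tendsto_diff[OF tendsto_const tendsto_power[OF lim, of 2], of "s\<^sup>2"] by simp
  ultimately have "(\<lambda>n. (norm (A (x n) - \<mu> n *\<^sub>R x n))\<^sup>2) \<longlonglongrightarrow> 0"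
    using Lim_null_comparison[of "\<lambda>n. (norm (A (x n) - \<mu> n *\<^sub>R x n))\<^sup>2" "\<lambda>n. s\<^sup>2 - \<bar>\<mu> n\<bar>\<^sup>2" sequentially]
    by simp
  then have "(\<lambda>n. norm (A (x n) - \<mu> n *\<^sub>R x n)) \<longlonglongrightarrow> 0"
    using tendsto_real_sqrt[of "\<lambda>n. (norm (A (x n) - \<mu> n *\<^sub>R x n))\<^sup>2" 0] by simp
  with x lim show ?thesis
    by (intro that[of x \<mu>]) (auto simp: \<mu>_def s_def)
qed

section \<open>Closure properties of symmetric operators\<close>

lemma symmetric_op_zero: "symmetric_op (\<lambda>x. 0)"
  by (simp add: symmetric_op_def bounded_clinear_def)

lemma symmetric_op_add:
  "symmetric_op A \<Longrightarrow> symmetric_op B \<Longrightarrow> symmetric_op (\<lambda>x. A x + B x)"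
  by (simp add: symmetric_op_def bounded_clinear_add cinner_simps)

lemma symmetric_op_diff:
  "symmetric_op A \<Longrightarrow> symmetric_op B \<Longrightarrow> symmetric_op (\<lambda>x. A x - B x)"
  by (simp add: symmetric_op_def bounded_clinear_diff cinner_simps)

lemma symmetric_op_scaleR: "symmetric_op A \<Longrightarrow> symmetric_op (\<lambda>x. r *\<^sub>R A x)"
  by (simp add: symmetric_op_def bounded_clinear_scaleR cinner_simps)

lemma symmetric_op_square: "symmetric_op A \<Longrightarrow> symmetric_op (\<lambda>x. A (A x))"
  by (simp add: symmetric_op_def bounded_clinear_compose)

lemma symmetric_op_ident: "symmetric_op (\<lambda>x. x)"
  by (simp add: symmetric_op_def bounded_clinear_ident)

lemma symmetric_op_blinfun_limit:
  fixes X :: "nat \<Rightarrow> 'a::complex_inner \<Rightarrow>\<^sub>L 'a"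
  assumes lim: "X \<longlonglongrightarrow> L" and sym: "\<And>n. symmetric_op (blinfun_apply (X n))"
  shows "symmetric_op (blinfun_apply L)"
proof -
  have conv: "(\<lambda>n. X n x) \<longlonglongrightarrow> L x" for x
    by (intro blinfun.tendsto lim tendsto_const)
  have "L (c *\<^sub>C x) = c *\<^sub>C L x" for c x
  proof (rule LIMSEQ_unique[OF conv])
    show "(\<lambda>n. X n (c *\<^sub>C x)) \<longlonglongrightarrow> c *\<^sub>C L x"
      using bounded_linear.tendsto[OF bounded_linear_scaleC conv, of c x]
      by (simp add: bounded_clinearD(2)[OF symmetric_opD(1)[OF sym]])
  qed
  moreover have "cinner (L x) y = cinner x (L y)" for x y
  proof (rule LIMSEQ_unique)
    show "(\<lambda>n. cinner (X n x) y) \<longlonglongrightarrow> cinner (L x) y"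
      by (intro cinner.tendsto conv tendsto_const)
    show "(\<lambda>n. cinner (X n x) y) \<longlonglongrightarrow> cinner x (L y)"
      unfolding symmetric_opD(2)[OF sym] by (intro cinner.tendsto conv tendsto_const)
  qed
  ultimately show ?thesis
    by (simp add: symmetric_op_def bounded_clinear_def blinfun.bounded_linear_right)
qed

subsection \<open>Square roots of positive operators\<close>

text \<open>If \<open>Y = (B + Y\<^sup>2) / 2\<close> then \<open>(1 - Y)\<^sup>2 = 1 - B\<close>. The fixed-point iteration converges in norm
  because the same iteration for the scalar \<open>1\<close> majorises it.\<close>

primrec sqrt_iter :: "('a::real_normed_vector \<Rightarrow>\<^sub>L 'a) \<Rightarrow> nat \<Rightarrow> 'a \<Rightarrow>\<^sub>L 'a" where
  "sqrt_iter B 0 = 0"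
| "sqrt_iter B (Suc n) = (1/2) *\<^sub>R (B + (sqrt_iter B n o\<^sub>L sqrt_iter B n))"

primrec scalar_sqrt_iter :: "nat \<Rightarrow> real" where
  "scalar_sqrt_iter 0 = 0"
| "scalar_sqrt_iter (Suc n) = (1 + (scalar_sqrt_iter n)\<^sup>2) / 2"

lemma scalar_sqrt_iter_bounds: "0 \<le> scalar_sqrt_iter n \<and> scalar_sqrt_iter n \<le> 1"
proof (induction n)
  case (Suc n)
  then have "(scalar_sqrt_iter n)\<^sup>2 \<le> 1" by (simp add: power_le_one)
  then show ?case by (simp add: add_nonneg_nonneg)
qed simp

text \<open>The increment is \<open>(scalar_sqrt_iter n - 1)\<^sup>2 / 2\<close>.\<close>

lemma scalar_sqrt_iter_mono: "scalar_sqrt_iter n \<le> scalar_sqrt_iter (Suc n)"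
  using zero_le_power2[of "scalar_sqrt_iter n - 1"]
  by (simp add: power2_eq_square algebra_simps)

lemma norm_sqrt_iter:
  assumes B: "norm B \<le> 1"
  shows "norm (sqrt_iter B n) \<le> scalar_sqrt_iter n"
proof (induction n)
  case (Suc n)
  have "norm (sqrt_iter B n o\<^sub>L sqrt_iter B n) \<le> norm (sqrt_iter B n) * norm (sqrt_iter B n)"
    by (rule norm_blinfun_compose)
  also have "\<dots> \<le> (scalar_sqrt_iter n)\<^sup>2"
    unfolding power2_eq_square using Suc scalar_sqrt_iter_bounds by (intro mult_mono) auto
  finally have "norm (B + (sqrt_iter B n o\<^sub>L sqrt_iter B n)) \<le> 1 + (scalar_sqrt_iter n)\<^sup>2"
    using B by (intro norm_triangle_le) linarith
  then show ?case by simp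
qed simp

lemma norm_sqrt_iter_diff:
  assumes B: "norm B \<le> 1"
  shows "norm (sqrt_iter B (Suc n) - sqrt_iter B n) \<le> scalar_sqrt_iter (Suc n) - scalar_sqrt_iter n"
proof (induction n)
  case (Suc n)
  define Y Z where "Y = sqrt_iter B (Suc n)" and "Z = sqrt_iter B n"
  define y z where "y = scalar_sqrt_iter (Suc n)" and "z = scalar_sqrt_iter n"
  have IH: "norm (Y - Z) \<le> y - z" using Suc by (simp only: Y_def Z_def y_def z_def)
  have Yy: "norm Y \<le> y" "norm Z \<le> z" unfolding Y_def Z_def y_def z_def by (intro norm_sqrt_iter B)+
  \<comment> \<open>This splitting assumes no commutation of \<open>Y\<close> and \<open>Z\<close>,
    and its scalar analogue is
    \<open>y * (y - z) + (y - z) * z = y\<^sup>2 - z\<^sup>2\<close>.\<close>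
  have eq: "(Y o\<^sub>L Y) - (Z o\<^sub>L Z) = (Y o\<^sub>L (Y - Z)) + ((Y - Z) o\<^sub>L Z)"
    by (rule blinfun_eqI) (simp add: blinfun.diff_right blinfun.diff_left blinfun.add_left)
  have "norm ((Y o\<^sub>L Y) - (Z o\<^sub>L Z)) \<le> norm Y * norm (Y - Z) + norm (Y - Z) * norm Z"
    unfolding eq by (intro norm_triangle_le add_mono norm_blinfun_compose)
  also have "\<dots> \<le> y * (y - z) + (y - z) * z"
    using IH Yy order_trans[OF norm_ge_zero IH] order_trans[OF norm_ge_zero Yy(1)]
    by (intro add_mono mult_mono) auto
  also have "\<dots> = y\<^sup>2 - z\<^sup>2" by (simp add: power2_eq_square algebra_simps)
  finally have "norm ((1/2) *\<^sub>R ((Y o\<^sub>L Y) - (Z o\<^sub>L Z))) \<le> (y\<^sup>2 - z\<^sup>2) / 2" by simp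
  moreover have "sqrt_iter B (Suc (Suc n)) = (1/2) *\<^sub>R (B + (Y o\<^sub>L Y))"
    and "sqrt_iter B (Suc n) = (1/2) *\<^sub>R (B + (Z o\<^sub>L Z))"
    unfolding Y_def Z_def by (rule sqrt_iter.simps(2))+
  then have "sqrt_iter B (Suc (Suc n)) - sqrt_iter B (Suc n) = (1/2) *\<^sub>R ((Y o\<^sub>L Y) - (Z o\<^sub>L Z))"
    by (simp only: scaleR_right_diff_distrib[symmetric] add_diff_cancel_left)
  moreover have "scalar_sqrt_iter (Suc (Suc n)) = (1 + y\<^sup>2) / 2" "scalar_sqrt_iter (Suc n) = (1 + z\<^sup>2) / 2"
    unfolding y_def z_def by (rule scalar_sqrt_iter.simps(2))+
  then have "scalar_sqrt_iter (Suc (Suc n)) - scalar_sqrt_iter (Suc n) = (y\<^sup>2 - z\<^sup>2) / 2"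
    by (simp only: diff_divide_distrib[symmetric] add_diff_cancel_left)
  ultimately show ?case by (simp only:)
qed (use B in simp)

text \<open>The scalar iterates increase and are bounded, so their increments are summable; by
  comparison the operator increments are absolutely summable.\<close>

lemma sqrt_iter_limit:
  fixes B :: "'a::banach \<Rightarrow>\<^sub>L 'a"
  assumes B: "norm B \<le> 1"
  obtains Y where "sqrt_iter B \<longlonglongrightarrow> Y" "norm Y \<le> 1" "2 *\<^sub>R Y = B + (Y o\<^sub>L Y)"
proof -
  have "incseq scalar_sqrt_iter" by (intro incseq_SucI scalar_sqrt_iter_mono)
  then obtain c where "scalar_sqrt_iter \<longlonglongrightarrow> c"
    using incseq_convergent[of scalar_sqrt_iter 1] scalar_sqrt_iter_bounds by blast
  then have "summable (\<lambda>n. scalar_sqrt_iter (Suc n) - scalar_sqrt_iter n)"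
    by (rule telescope_summable)
  then have "summable (\<lambda>n. sqrt_iter B (Suc n) - sqrt_iter B n)"
    by (rule summable_comparison_test'[where N = 0]) (intro norm_sqrt_iter_diff B)
  then have "convergent (\<lambda>n. \<Sum>k<n. sqrt_iter B (Suc k) - sqrt_iter B k)"
    by (simp add: summable_iff_convergent)
  \<comment> \<open>The partial sums telescope to the iterates because the iteration starts at
    0.\<close>
  then have "convergent (sqrt_iter B)" by (simp only: sum_lessThan_telescope) simp
  then obtain Y where Y: "sqrt_iter B \<longlonglongrightarrow> Y" by (auto simp: convergent_def)
  have "norm Y \<le> 1"
  proof (rule LIMSEQ_le_const2)
    show "(\<lambda>n. norm (sqrt_iter B n)) \<longlonglongrightarrow> norm Y" by (intro tendsto_norm Y)
    show "\<exists>N. \<forall>n\<ge>N. norm (sqrt_iter B n) \<le> 1"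
      using norm_sqrt_iter[OF B] scalar_sqrt_iter_bounds order_trans by blast
  qed
  moreover have "Y = (1/2) *\<^sub>R (B + (Y o\<^sub>L Y))"
  proof (rule LIMSEQ_unique[OF LIMSEQ_Suc[OF Y]])
    show "(\<lambda>n. sqrt_iter B (Suc n)) \<longlonglongrightarrow> (1/2) *\<^sub>R (B + (Y o\<^sub>L Y))"
      unfolding sqrt_iter.simps
      by (intro tendsto_scaleR tendsto_add tendsto_const 
          bounded_bilinear.tendsto[OF bounded_bilinear_blinfun_compose] Y)
  qed
  then have "2 *\<^sub>R Y = 2 *\<^sub>R ((1/2) *\<^sub>R (B + (Y o\<^sub>L Y)))" by simp
  then have "2 *\<^sub>R Y = B + (Y o\<^sub>L Y)" by simp
  ultimately show ?thesis using Y that by blast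
qed

section \<open>Positive operators and their square roots\<close>

lemma positive_opD:
  assumes "positive_op P"
  shows "bounded_clinear P" "0 \<le> Re (cinner (P x) x)" "Im (cinner (P x) x) = 0"
  using assms by (auto simp: positive_op_def complex_nonneg_Reals_iff)

text \<open>Reality of the quadratic form at \<open>x + y\<close> relates the imaginary parts, and
  at \<open>x + \<i> *\<^sub>C y\<close> the real parts.\<close>

lemma positive_op_symmetric:
  assumes "positive_op P"
  shows "symmetric_op P"
proof -
  note lin = bounded_clinearD[OF positive_opD(1)[OF assms]]
  note Im = positive_opD(3)[OF assms]
  have "cinner (P x) y = cinner x (P y)" for x y
  proof -
    have "Im (cinner (P x) y) = - Im (cinner (P y) x)"
      using Im[of "x + y"] Im[of x] Im[of y] by (simp add: lin cinner_simps)
    moreover have "Re (cinner (P x) y) = Re (cinner (P y) x)"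
      using Im[of "x + \<i> *\<^sub>C y"] Im[of x] Im[of y] by (simp add: lin cinner_simps)
    ultimately have "cinner (P x) y = cnj (cinner (P y) x)" by (simp add: complex_eq_iff)
    then show ?thesis by (subst cinner_commute) 
  qed
  then show ?thesis using lin(1) positive_opD(1)[OF assms] by (simp add: symmetric_op_def)
qed

lemma positive_opI:
  assumes "symmetric_op P" "\<And>x. 0 \<le> Re (cinner (P x) x)"
  shows "positive_op P"
  unfolding positive_op_def complex_nonneg_Reals_iff
  using assms symmetric_op_cinner_real[OF assms(1)] symmetric_opD(1)[OF assms(1)]
  by (metis Im_complex_of_real)

text \<open>After scaling, \<open>b = 1 - A / k\<close> is a symmetric contraction. The iteration
  gives a symmetric contraction \<open>Y\<close> with
  \<open>(1 - Y)\<^sup>2 = 1 - b = A / k\<close>, so \<open>sqrt k\<close> times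
  \<open>1 - Y\<close> is a positive square root of \<open>A\<close>.\<close>

lemma positive_sqrt_exists:
  fixes A :: "'a::chilbert_space \<Rightarrow> 'a"
  assumes A: "positive_op A"
  shows "\<exists>P. positive_op P \<and> P \<circ> P = A"
proof -
  note sym = positive_op_symmetric[OF A]
  \<comment> \<open>The added 1 keeps the divisor \<open>k\<close> positive even for
    \<open>A = 0\<close>.\<close>
  define k where "k = numerical_radius A + 1"
  have k: "k > 0" using numerical_radius_nonneg[OF positive_opD(1)[OF A]] by (simp add: k_def)
  have Ak: "Re (cinner (A x) x) \<le> k * (norm x)\<^sup>2" for x
  proof -
    have "Re (cinner (A x) x) \<le> cmod (cinner (A x) x)" by (rule complex_Re_le_cmod)
    also have "\<dots> \<le> numerical_radius A * (norm x)\<^sup>2"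
      by (rule cmod_cinner_le_numerical_radius[OF positive_opD(1)[OF A]])
    also have "\<dots> \<le> k * (norm x)\<^sup>2" by (simp add: k_def mult_right_mono)
    finally show ?thesis .
  qed
  define b where "b = (\<lambda>x. x - (1/k) *\<^sub>R A x)"
  have b: "symmetric_op b"
    unfolding b_def by (intro symmetric_op_diff symmetric_op_ident symmetric_op_scaleR sym)
  have "\<bar>Re (cinner (b x) x)\<bar> \<le> 1 * (norm x)\<^sup>2" for x
  proof -
    have "Re (cinner (b x) x) = (norm x)\<^sup>2 - Re (cinner (A x) x) / k"
      by (simp add: b_def cinner_simps cinner_self flip: of_real_power)
    moreover have "0 \<le> Re (cinner (A x) x) / k" using positive_opD(2)[OF A] k by simp
    moreover have "Re (cinner (A x) x) / k \<le> (norm x)\<^sup>2" using Ak[of x] k by (simp add: field_simps)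
    ultimately show ?thesis by linarith
  qed
  from symmetric_op_norm_le[OF b this] have nb: "norm (b x) \<le> norm x" for x by simp
  define B where "B = Blinfun b"
  have B: "blinfun_apply B = b"
    unfolding B_def using bounded_clinearD(1)[OF symmetric_opD(1)[OF b]] by (rule bounded_linear_Blinfun_apply)
  have "norm B \<le> 1" by (rule norm_blinfun_bound) (use nb in \<open>simp_all add: B\<close>)
  then obtain Y where Y: "sqrt_iter B \<longlonglongrightarrow> Y" "norm Y \<le> 1" "2 *\<^sub>R Y = B + (Y o\<^sub>L Y)"
    by (rule sqrt_iter_limit)
  have "symmetric_op (blinfun_apply (sqrt_iter B n))" for n
  proof (induction n)
    case 0
    have "blinfun_apply (sqrt_iter B 0) = (\<lambda>x. 0)" by (simp add: fun_eq_iff)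
    then show ?case by (simp add: symmetric_op_zero)
  next
    case (Suc n)
    have "blinfun_apply (sqrt_iter B (Suc n)) = (\<lambda>x. (1/2) *\<^sub>R (b x + sqrt_iter B n (sqrt_iter B n x)))"
      by (simp add: fun_eq_iff blinfun.scaleR_left blinfun.add_left B)
    then show ?case
      using symmetric_op_scaleR[OF symmetric_op_add[OF b symmetric_op_square[OF Suc]]] by simp
  qed
  then have symY: "symmetric_op (blinfun_apply Y)"
    by (rule symmetric_op_blinfun_limit[OF Y(1)])
  have YY: "Y (Y x) = 2 *\<^sub>R Y x - b x" for x
  proof -
    have "blinfun_apply (2 *\<^sub>R Y) x = blinfun_apply (B + (Y o\<^sub>L Y)) x" using Y(3) by simp
    then show ?thesis by (simp add: blinfun.scaleR_left blinfun.add_left B)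
  qed
  define P where "P = (\<lambda>x. sqrt k *\<^sub>R (x - Y x))"
  have "symmetric_op P"
    unfolding P_def by (intro symmetric_op_scaleR symmetric_op_diff symmetric_op_ident symY)
  moreover have "0 \<le> Re (cinner (P x) x)" for x
  proof -
    have "Re (cinner (Y x) x) \<le> norm (Y x) * norm x" by (rule Re_cinner_le)
    also have "norm (Y x) \<le> norm x"
      using norm_blinfun[of Y x] mult_right_mono[OF Y(2) norm_ge_zero[of x]] by simp
    finally have "Re (cinner (Y x) x) \<le> (norm x)\<^sup>2"
      by (simp add: power2_eq_square mult_right_mono)
    then show ?thesis using k
      by (simp add: P_def cinner_simps cinner_self flip: of_real_power)
  qed
  ultimately have "positive_op P" by (rule positive_opI)
  moreover have "P (P x) = A x" for x
  proof -
    have "P (P x) = (sqrt k * sqrt k) *\<^sub>R (x - 2 *\<^sub>R Y x + Y (Y x))"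
      by (simp add: P_def blinfun.scaleR_right blinfun.diff_right algebra_simps scaleR_2)
    also have "\<dots> = A x" using k by (simp add: YY b_def)
    finally show ?thesis .
  qed
  ultimately show ?thesis by (intro exI[of _ P]) (auto simp: fun_eq_iff)
qed

text \<open>If \<open>P\<^sup>2 = Q\<^sup>2\<close> then \<open>\<langle>(P - Q) x, (P + Q) x\<rangle>\<close> has real part \<open>0\<close>; testing this on approximate
  eigenvectors of \<open>P - Q\<close> shows that \<open>P - Q\<close> has numerical radius \<open>0\<close>.\<close>

lemma positive_sqrt_unique:
  fixes P Q :: "'a::chilbert_space \<Rightarrow> 'a"
  assumes P: "positive_op P" and Q: "positive_op Q" and eq: "P \<circ> P = Q \<circ> Q"
  shows "P = Q"
proof -
  note sP = positive_op_symmetric[OF P] and sQ = positive_op_symmetric[OF Q]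
  have sD: "symmetric_op (\<lambda>x. P x - Q x)" by (intro symmetric_op_diff sP sQ)
  have bS: "bounded_clinear (\<lambda>x. P x + Q x)"
    by (intro bounded_clinear_add symmetric_opD(1) sP sQ)
  then obtain K where K: "K \<ge> 0" "\<And>x. norm (P x + Q x) \<le> K * norm x"
    using bounded_clinear_bound by blast
  have PQ: "Re (cinner (P x - Q x) (P x + Q x)) = 0" for x
  proof -
    have "P (P x) = Q (Q x)" using eq by (metis comp_apply)
    then have "cinner (P x) (P x) = cinner (Q x) (Q x)"
      using symmetric_opD(2)[OF sP, of x "P x"] symmetric_opD(2)[OF sQ, of x "Q x"] by simp
    then show ?thesis using Re_cinner_commute[of "P x" "Q x"] by (simp add: cinner_simps)
  qed
  define s where "s = numerical_radius (\<lambda>x. P x - Q x)"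
  have "s = 0"
  proof (rule ccontr)
    assume "s \<noteq> 0"
    then have "0 < s"
      using numerical_radius_nonneg[OF symmetric_opD(1)[OF sD]] by (simp add: s_def)
    then obtain x \<mu> where x: "\<And>n. norm (x n) = 1"
      and \<mu>: "\<And>n. \<mu> n = Re (cinner (P (x n) - Q (x n)) (x n))"
      and lim: "(\<lambda>n. \<bar>\<mu> n\<bar>) \<longlonglongrightarrow> s"
      and lim0: "(\<lambda>n. norm (P (x n) - Q (x n) - \<mu> n *\<^sub>R x n)) \<longlonglongrightarrow> 0"
      unfolding s_def by (rule approximate_eigenvector[OF sD]) blast
    have le: "\<bar>\<mu> n\<bar>\<^sup>2 \<le> K * norm (P (x n) - Q (x n) - \<mu> n *\<^sub>R x n)" for n
    proof -
      define d where "d = P (x n) - Q (x n) - \<mu> n *\<^sub>R x n"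
      define r where "r = Re (cinner (x n) (P (x n) + Q (x n)))"
      \<comment> \<open>A difference of two nonnegative numbers is at most their sum in absolute
        value.\<close>
      have r: "\<bar>\<mu> n\<bar> \<le> r"
        using positive_opD(2)[OF P, of "x n"] positive_opD(2)[OF Q, of "x n"]
        by (simp add: \<mu> r_def cinner_simps Re_cinner_commute[of "x n"])
      have "\<bar>\<mu> n\<bar>\<^sup>2 \<le> \<bar>\<mu> n\<bar> * r"
        unfolding power2_eq_square by (intro mult_left_mono r) auto
      \<comment> \<open>Substituting \<open>d\<close> for the difference minus
        \<open>\<mu> n *\<^sub>R x n\<close> and using \<open>PQ\<close> leaves only
        \<open>- \<mu> n * r\<close> as real part.\<close>
      also have "\<dots> = \<bar>Re (cinner d (P (x n) + Q (x n)))\<bar>"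
        using PQ[of "x n"] r
        by (simp add: d_def r_def abs_mult cinner_diff_left[of "P (x n) - Q (x n)"] cinner_scaleR_left)
      also have "\<dots> \<le> cmod (cinner d (P (x n) + Q (x n)))" by (rule abs_Re_le_cmod)
      also have "\<dots> \<le> norm d * norm (P (x n) + Q (x n))" by (rule cmod_cinner_le)
      also have "\<dots> \<le> norm d * K" using K(2)[of "x n"] x by (intro mult_left_mono) auto
      finally show ?thesis by (simp add: d_def mult.commute)
    qed
    have "(\<lambda>n. K * norm (P (x n) - Q (x n) - \<mu> n *\<^sub>R x n)) \<longlonglongrightarrow> 0"
      using tendsto_mult_right_zero[OF lim0] by simp
    with tendsto_power[OF lim, of 2] have "s\<^sup>2 \<le> 0"
      using le by (intro LIMSEQ_le) auto
    with \<open>0 < s\<close> show False by simp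
  qed
  then have "norm (P x - Q x) \<le> 0" for x
    using norm_le_numerical_radius[OF sD, of x] by (simp add: s_def)
  then show ?thesis by (simp add: fun_eq_iff)
qed

text \<open>Existence and uniqueness of the positive square root of
  \<open>cadjoint T \<circ> T\<close> resolve the definite description; symmetry of
  \<open>abs_op T\<close> then moves one factor across the inner product.\<close>

lemma
  fixes T :: "'a::chilbert_space \<Rightarrow> 'a"
  assumes T: "bounded_clinear T"
  shows positive_abs_op: "positive_op (abs_op T)"
    and cinner_abs_op: "cinner (abs_op T x) (abs_op T y) = cinner (T x) (T y)"
    and norm_abs_op: "norm (abs_op T x) = norm (T x)"
proof -
  let ?P = "\<lambda>P. positive_op P \<and> P \<circ> P = cadjoint T \<circ> T"
  have "positive_op (cadjoint T \<circ> T)"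
    unfolding positive_op_def comp_def complex_nonneg_Reals_iff
    by (simp add: bounded_clinear_compose bounded_clinear_cadjoint T cadjoint_left cinner_self)
  then have "\<exists>P. ?P P" by (rule positive_sqrt_exists)
  moreover have "P = Q" if "?P P" "?P Q" for P Q
    by (rule positive_sqrt_unique) (use that in simp_all)
  ultimately have "\<exists>!P. ?P P" by (rule ex_ex1I)
  then have P: "?P (abs_op T)" unfolding abs_op_def by (rule theI')
  then show "positive_op (abs_op T)" by blast
  then have sym: "symmetric_op (abs_op T)" by (rule positive_op_symmetric)
  have sq: "abs_op T (abs_op T x) = cadjoint T (T x)" for x
    using P by (metis comp_apply)
  show *: "cinner (abs_op T x) (abs_op T y) = cinner (T x) (T y)" for x y
    by (simp add: symmetric_opD(2)[OF sym] sq cadjoint_right[OF T])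
  show "norm (abs_op T x) = norm (T x)"
    using *[of x x] by (simp add: norm_eq_sqrt_cinner)
qed

subsection \<open>The polar decomposition\<close>

text \<open>\<open>p\<close> is the orthogonal projection of \<open>x\<close> onto the closure of the range of \<open>|T|\<close>, and \<open>u\<close> is the
  image of \<open>p\<close> under the continuous extension of \<open>|T| z \<mapsto> T z\<close>.\<close>

definition polar_rel :: "('a::chilbert_space \<Rightarrow> 'a) \<Rightarrow> 'a \<Rightarrow> 'a \<Rightarrow> 'a \<Rightarrow> bool" where
  "polar_rel T x p u \<longleftrightarrow> (\<forall>z. cinner (x - p) (abs_op T z) = 0) \<and>
     (\<exists>X. (\<lambda>n. abs_op T (X n)) \<longlonglongrightarrow> p \<and> (\<lambda>n. T (X n)) \<longlonglongrightarrow> u)"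

lemma polar_relI:
  assumes "(\<lambda>n. abs_op T (X n)) \<longlonglongrightarrow> p" "(\<lambda>n. T (X n)) \<longlonglongrightarrow> u"
    and "\<And>z. cinner (x - p) (abs_op T z) = 0"
  shows "polar_rel T x p u"
  using assms unfolding polar_rel_def by blast

context
  fixes T :: "'a::chilbert_space \<Rightarrow> 'a"
  assumes T: "bounded_clinear T"
begin

lemma symmetric_abs_op: "symmetric_op (abs_op T)"
  by (intro positive_op_symmetric positive_abs_op T)

lemmas abs_op_lin = bounded_clinearD[OF symmetric_opD(1)[OF symmetric_abs_op]]

text \<open>The approximants are kept in the form \<open>abs_op T (X n)\<close> so that the sequence
  \<open>T (X n)\<close> can be formed.\<close>

lemma projection_abs_op_range:
  obtains X p where "(\<lambda>n. abs_op T (X n)) \<longlonglongrightarrow> p" "\<And>z. cinner (x - p) (abs_op T z) = 0"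
proof -
  have zero: "0 \<in> range (abs_op T)"
    using abs_op_lin(6) by (simp add: image_iff exI[of _ 0])
  have add: "a + b \<in> range (abs_op T)" if "a \<in> range (abs_op T)" "b \<in> range (abs_op T)" for a b
    using that by (auto simp flip: abs_op_lin(3))
  have scale: "c *\<^sub>C a \<in> range (abs_op T)" if "a \<in> range (abs_op T)" for a c
    using that by (auto simp flip: abs_op_lin(2))
  obtain Y p where Y: "\<And>n. Y n \<in> range (abs_op T)" "Y \<longlonglongrightarrow> p"
    "\<And>m. m \<in> range (abs_op T) \<Longrightarrow> cinner (x - p) m = 0"
    using orthogonal_projection[OF zero add scale, of x] by blast
  have "\<forall>n. \<exists>z. Y n = abs_op T z" using Y(1) by blast
  then obtain X where "\<forall>n. Y n = abs_op T (X n)" by (rule choice[THEN exE])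
  then have "Y = (\<lambda>n. abs_op T (X n))" by (simp add: fun_eq_iff)
  with Y(2,3) show ?thesis by (intro that[of X p]) auto
qed

text \<open>\<open>T\<close> and \<open>abs_op T\<close> have equal norms on differences, so
  \<open>T (X n)\<close> is Cauchy along with \<open>abs_op T (X n)\<close>.\<close>

lemma polar_rel_exists: "\<exists>p u. polar_rel T x p u"
proof -
  obtain X p where X: "(\<lambda>n. abs_op T (X n)) \<longlonglongrightarrow> p" "\<And>z. cinner (x - p) (abs_op T z) = 0"
    by (rule projection_abs_op_range) blast
  have "dist (T (X m)) (T (X n)) = dist (abs_op T (X m)) (abs_op T (X n))" for m n
    using norm_abs_op[OF T, of "X m - X n"]
    by (simp add: dist_norm bounded_clinearD(4)[OF T] abs_op_lin)
  then have "Cauchy (\<lambda>n. T (X n))"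
    using LIMSEQ_imp_Cauchy[OF X(1)] by (simp add: Cauchy_def)
  then obtain u where "(\<lambda>n. T (X n)) \<longlonglongrightarrow> u"
    unfolding Cauchy_convergent_iff convergent_def by blast
  with X show ?thesis unfolding polar_rel_def by blast
qed

lemma polar_rel_add:
  assumes "polar_rel T x p u" "polar_rel T y q v"
  shows "polar_rel T (x + y) (p + q) (u + v)"
proof -
  from assms obtain X Y where X: "(\<lambda>n. abs_op T (X n)) \<longlonglongrightarrow> p" "(\<lambda>n. T (X n)) \<longlonglongrightarrow> u"
    and Y: "(\<lambda>n. abs_op T (Y n)) \<longlonglongrightarrow> q" "(\<lambda>n. T (Y n)) \<longlonglongrightarrow> v"
    unfolding polar_rel_def by blast
  have "(\<lambda>n. abs_op T (X n + Y n)) \<longlonglongrightarrow> p + q" "(\<lambda>n. T (X n + Y n)) \<longlonglongrightarrow> u + v"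
    unfolding abs_op_lin(3) bounded_clinearD(3)[OF T] by (intro tendsto_add X Y)+
  moreover have "cinner (x + y - (p + q)) (abs_op T z) = 0" for z
    using assms by (simp add: polar_rel_def cinner_simps)
  ultimately show ?thesis by (intro polar_relI)
qed

lemma polar_rel_scaleC:
  assumes "polar_rel T x p u"
  shows "polar_rel T (c *\<^sub>C x) (c *\<^sub>C p) (c *\<^sub>C u)"
proof -
  from assms obtain X where X: "(\<lambda>n. abs_op T (X n)) \<longlonglongrightarrow> p" "(\<lambda>n. T (X n)) \<longlonglongrightarrow> u"
    unfolding polar_rel_def by blast
  have "(\<lambda>n. abs_op T (c *\<^sub>C X n)) \<longlonglongrightarrow> c *\<^sub>C p" "(\<lambda>n. T (c *\<^sub>C X n)) \<longlonglongrightarrow> c *\<^sub>C u"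
    unfolding abs_op_lin(2) bounded_clinearD(2)[OF T]
    by (intro bounded_linear.tendsto[OF bounded_linear_scaleC] X)+
  moreover have "cinner (c *\<^sub>C x - c *\<^sub>C p) (abs_op T z) = 0" for z
    using assms by (simp add: polar_rel_def cinner_scaleC_left flip: scaleC_diff_right)
  ultimately show ?thesis by (intro polar_relI)
qed

lemma polar_rel_norm:
  assumes "polar_rel T x p u"
  shows "norm u = norm p" and "cinner (x - p) p = 0" and "norm p \<le> norm x"
proof -
  from assms obtain X where X: "(\<lambda>n. abs_op T (X n)) \<longlonglongrightarrow> p" "(\<lambda>n. T (X n)) \<longlonglongrightarrow> u"
    and orth: "\<And>z. cinner (x - p) (abs_op T z) = 0"
    unfolding polar_rel_def by blast
  show "norm u = norm p"
    using LIMSEQ_unique[OF tendsto_norm[OF X(2)]] tendsto_norm[OF X(1)]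
    by (simp add: norm_abs_op[OF T])
  have "(\<lambda>n. cinner (x - p) (abs_op T (X n))) \<longlonglongrightarrow> cinner (x - p) p"
    by (intro cinner.tendsto tendsto_const X)
  then show "cinner (x - p) p = 0" by (simp add: orth LIMSEQ_const_iff)
  then have "(norm x)\<^sup>2 = (norm (x - p))\<^sup>2 + (norm p)\<^sup>2"
    using power2_norm_add[of "x - p" p] by simp
  then show "norm p \<le> norm x" by - (rule power2_le_imp_le, auto)
qed

text \<open>The relation is linear, so \<open>u - v\<close> is related to the vector 0, and related
  values never exceed the argument in norm.\<close>

lemma polar_rel_unique:
  assumes "polar_rel T x p u" "polar_rel T x q v"
  shows "u = v"
proof -
  have neg: "(-1) *\<^sub>C a = - a" for a :: 'a using scaleR_scaleC[of "-1" a] by simp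
  have "polar_rel T (x + (-1) *\<^sub>C x) (p + (-1) *\<^sub>C q) (u + (-1) *\<^sub>C v)"
    by (intro polar_rel_add polar_rel_scaleC assms)
  then have "norm (u - v) \<le> norm (0::'a)"
    using polar_rel_norm(1,3) by (fastforce simp: neg)
  then show ?thesis by simp
qed

text \<open>For the polar isometry \<open>U\<close> this says that the adjoint of \<open>U\<close>
  composed with \<open>T\<close> is \<open>abs_op T\<close>. Inner products agree along the
  approximants, and \<open>x - p\<close> is orthogonal to the range of
  \<open>abs_op T\<close>.\<close>

lemma polar_rel_cinner:
  assumes "polar_rel T x p u"
  shows "cinner (T z) u = cinner (abs_op T z) x"
proof -
  from assms obtain X where X: "(\<lambda>n. abs_op T (X n)) \<longlonglongrightarrow> p" "(\<lambda>n. T (X n)) \<longlonglongrightarrow> u"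
    and orth: "\<And>z. cinner (x - p) (abs_op T z) = 0"
    unfolding polar_rel_def by blast
  have "(\<lambda>n. cinner (T z) (T (X n))) \<longlonglongrightarrow> cinner (T z) u"
    and "(\<lambda>n. cinner (abs_op T z) (abs_op T (X n))) \<longlonglongrightarrow> cinner (abs_op T z) p"
    by (intro cinner.tendsto tendsto_const X)+
  then have "cinner (T z) u = cinner (abs_op T z) p"
    by (simp add: cinner_abs_op[OF T] LIMSEQ_unique)
  also have "\<dots> = cinner (abs_op T z) x"
    using orth[of z] cinner_commute[of "abs_op T z" "x - p"] by (simp add: cinner_simps)
  finally show ?thesis .
qed

lemma polar_rel_abs_op: "polar_rel T (abs_op T x) (abs_op T x) (T x)"
  unfolding polar_rel_def by (auto intro!: exI[of _ "\<lambda>_. x"])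

lemma abs_op_eq_0_iff: "abs_op T x = 0 \<longleftrightarrow> T x = 0"
  by (metis norm_abs_op[OF T] norm_eq_zero)

lemma abs_op_eq_0I: "(\<And>z. cinner x (abs_op T z) = 0) \<Longrightarrow> abs_op T x = 0"
  by (rule cinner_ext) (simp add: symmetric_opD(2)[OF symmetric_abs_op])

text \<open>A choice of related values is linear and contractive by uniqueness of such values. The
  conjunct on \<open>polar_rel\<close> is kept for the later estimate of the Duggal
  transform.\<close>

lemma polar_isometry_exists:
  "\<exists>U. (partial_isometry U \<and> T = U \<circ> abs_op T \<and> null_space U = null_space T) \<and>
     (\<forall>x. \<exists>p. polar_rel T x p (U x))"
proof -
  obtain U p where U: "\<And>x. polar_rel T x (p x) (U x)" using polar_rel_exists by metis
  have lin: "bounded_clinear U"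
  proof (rule bounded_clinearI[of _ 1])
    show "U (x + y) = U x + U y" for x y
      by (rule polar_rel_unique[OF U polar_rel_add[OF U U]])
    show "U (c *\<^sub>C x) = c *\<^sub>C U x" for c x
      by (rule polar_rel_unique[OF U polar_rel_scaleC[OF U]])
    show "norm (U x) \<le> 1 * norm x" for x
      using polar_rel_norm[OF U] by simp
  qed
  have TU: "T x = U (abs_op T x)" for x
    by (rule polar_rel_unique[OF polar_rel_abs_op U])
  have null: "U x = 0 \<longleftrightarrow> T x = 0" for x
  proof
    assume "U x = 0"
    then have "cinner x (abs_op T z) = 0" for z
      using polar_rel_cinner[OF U, of z x] cinner_commute[of x] by simp
    then show "T x = 0" using abs_op_eq_0I abs_op_eq_0_iff by blast
  next
    assume "T x = 0"
    then have "abs_op T x = 0" by (simp add: abs_op_eq_0_iff)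
    then have "cinner x (abs_op T z) = 0" for z
      using symmetric_opD(2)[OF symmetric_abs_op, of x z] by simp
    then have "polar_rel T x 0 0"
      unfolding polar_rel_def
      by (auto simp: abs_op_lin(6) bounded_clinearD(6)[OF T] intro!: exI[of _ "\<lambda>_. 0"])
    then show "U x = 0" by (rule polar_rel_unique[OF U])
  qed
  \<comment> \<open>The remainder \<open>x - p x\<close> lies in the null space of \<open>U\<close>,
    hence is orthogonal to \<open>x\<close> as well as to \<open>p x\<close>, and so
    vanishes.\<close>
  have "norm (U x) = norm x" if orth: "\<forall>y\<in>null_space U. cinner x y = 0" for x
  proof -
    have "T (x - p x) = 0"
      using U abs_op_eq_0I abs_op_eq_0_iff unfolding polar_rel_def by blast
    then have "cinner x (x - p x) = 0" using orth by (simp add: null_space_def null)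
    moreover have "cinner (p x) (x - p x) = 0"
      using polar_rel_norm(2)[OF U, of x] cinner_commute[of "p x"] by simp
    ultimately have "cinner (x - p x) (x - p x) = 0" by (simp add: cinner_diff_left)
    then have "x = p x" by (simp add: cinner_self)
    then show ?thesis using polar_rel_norm(1)[OF U, of x] by simp
  qed
  then have "partial_isometry U" using lin by (simp add: partial_isometry_def)
  moreover have "null_space U = null_space T" by (simp add: null_space_def null)
  ultimately show ?thesis using TU U by (intro exI[of _ U]) (auto simp: fun_eq_iff)
qed

text \<open>Both maps are determined on the closure of the range of \<open>abs_op T\<close> by
  continuity, and both vanish on the remainder \<open>x - p\<close>.\<close>

lemma polar_isometry_unique:
  assumes U: "partial_isometry U" "T = U \<circ> abs_op T" "null_space U = null_space T"
    and V: "partial_isometry V" "T = V \<circ> abs_op T" "null_space V = null_space T"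
  shows "U = V"
proof
  fix x
  have lin: "bounded_clinear U" "bounded_clinear V" using U V by (auto simp: partial_isometry_def)
  obtain X p where X: "(\<lambda>n. abs_op T (X n)) \<longlonglongrightarrow> p" "\<And>z. cinner (x - p) (abs_op T z) = 0"
    by (rule projection_abs_op_range) blast
  have "T (x - p) = 0" using X(2) abs_op_eq_0I abs_op_eq_0_iff by blast
  then have "U (x - p) = 0" "V (x - p) = 0"
    using U(3) V(3) by (auto simp: null_space_def)
  moreover have "U (abs_op T z) = V (abs_op T z)" for z
    using U(2) V(2) by (metis comp_apply)
  then have "U p = V p"
    using bounded_linear.tendsto[OF bounded_clinearD(1)[OF lin(1)] X(1)]
      bounded_linear.tendsto[OF bounded_clinearD(1)[OF lin(2)] X(1)]
    by (simp add: LIMSEQ_unique)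
  ultimately show "U x = V x" by (simp add: bounded_clinearD(4)[OF lin(1)] bounded_clinearD(4)[OF lin(2)])
qed

lemma polar_isometry:
  shows "bounded_clinear (polar_isometry T)"
    and "\<exists>p. polar_rel T x p (polar_isometry T x)"
proof -
  obtain U where U: "partial_isometry U \<and> T = U \<circ> abs_op T \<and> null_space U = null_space T"
    and rel: "\<And>x. \<exists>p. polar_rel T x p (U x)"
    using polar_isometry_exists by blast
  have "polar_isometry T = U"
    unfolding polar_isometry_def
    using U polar_isometry_unique by (intro the_equality) blast+
  then show "bounded_clinear (polar_isometry T)" "\<exists>p. polar_rel T x p (polar_isometry T x)"
    using U rel by (auto simp: partial_isometry_def)
qed

lemma bounded_clinear_duggal: "bounded_clinear (duggal T)"
  unfolding duggal_def comp_def
  by (rule bounded_clinear_compose[OF symmetric_opD(1)[OF symmetric_abs_op] polar_isometry(1)])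

text \<open>Since \<open>|T| = U\<^sup>* T\<close>, the Duggal transform is the compression \<open>U\<^sup>* T U\<close>.\<close>

lemma numerical_radius_duggal_le: "numerical_radius (duggal T) \<le> numerical_radius T"
proof (rule numerical_radius_le[OF numerical_radius_nonneg[OF T]])
  fix x :: 'a assume x: "norm x = 1"
  define U where "U = polar_isometry T"
  obtain p where p: "polar_rel T x p (U x)" unfolding U_def using polar_isometry(2) by blast
  have "cmod (cinner (duggal T x) x) = cmod (cinner (T (U x)) (U x))"
    by (simp add: duggal_def polar_rel_cinner[OF p] flip: U_def)
  also have "\<dots> \<le> numerical_radius T * (norm (U x))\<^sup>2"
    by (rule cmod_cinner_le_numerical_radius[OF T])
  also have "\<dots> \<le> numerical_radius T * 1"
    using polar_rel_norm(1,3)[OF p] x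
    by (intro mult_left_mono numerical_radius_nonneg T) (auto simp: power_le_one)
  finally show "cmod (cinner (duggal T x) x) \<le> numerical_radius T" by simp
qed

end

subsection \<open>The norm of a sum of symmetric operators\<close>

text \<open>The right-hand side is the larger root of \<open>(s - a) * (s - b) = c\<close>, and it
  dominates \<open>a\<close> and \<open>b\<close> because \<open>c\<close> is nonnegative.\<close>

lemma norm_sum_bound:
  fixes a b c s :: real
  assumes "s \<le> a \<or> s \<le> b \<or> (s - a) * (s - b) \<le> c" and "0 \<le> c"
  shows "s \<le> 1/2 * (a + b) + 1/2 * sqrt ((a - b)\<^sup>2 + 4 * c)"
proof (cases "s \<le> a \<or> s \<le> b")
  case True
  define r where "r = sqrt ((a - b)\<^sup>2 + 4 * c)"
  have "\<bar>a - b\<bar> \<le> r"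
    unfolding r_def using assms(2) by (intro real_le_rsqrt) simp
  with True show ?thesis unfolding r_def[symmetric] by argo
next
  case False
  have "(2 * s - a - b)\<^sup>2 = (a - b)\<^sup>2 + 4 * ((s - a) * (s - b))"
    by (simp add: power2_eq_square algebra_simps)
  also have "\<dots> \<le> (a - b)\<^sup>2 + 4 * c" using assms False by simp
  finally have "2 * s - a - b \<le> sqrt ((a - b)\<^sup>2 + 4 * c)" by (rule real_le_rsqrt)
  then show ?thesis by argo
qed

text \<open>If \<open>(A + B) x = \<mu> x\<close> with \<open>norm x = 1\<close>, then \<open>\<bar>\<mu>\<bar> \<le> norm (A x) + b\<close>, and applying \<open>A\<close> gives
  \<open>\<bar>\<mu>\<bar> * norm (A x) \<le> a * norm (A x) + c\<close>; together \<open>(\<bar>\<mu>\<bar> - a) * (\<bar>\<mu>\<bar> - b) \<le> c\<close>.\<close>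

lemma numerical_radius_symmetric_sum_le:
  fixes A B :: "'a::chilbert_space \<Rightarrow> 'a"
  assumes A: "symmetric_op A" and B: "symmetric_op B" and c: "0 \<le> c"
    and a: "0 \<le> a" "\<And>x. norm (A x) \<le> a * norm x"
    and b: "\<And>x. norm (B x) \<le> b * norm x"
    and AB: "\<And>x. norm (A (B x)) \<le> c * norm x"
  shows "numerical_radius (\<lambda>x. A x + B x) \<le> 1/2 * (a + b) + 1/2 * sqrt ((a - b)\<^sup>2 + 4 * c)"
proof -
  note lin = bounded_clinearD[OF symmetric_opD(1)[OF A]]
  have sS: "symmetric_op (\<lambda>x. A x + B x)" by (intro symmetric_op_add A B)
  define s where "s = numerical_radius (\<lambda>x. A x + B x)"
  \<comment> \<open>For \<open>a < s\<close> the factor \<open>\<bar>\<mu> n\<bar> - a\<close> is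
    eventually positive, so the lower bound on \<open>norm (A (x n))\<close> may be multiplied by
    it. The case \<open>s \<le> a\<close> is left to \<open>norm_sum_bound\<close>.\<close>
  have "(s - a) * (s - b) \<le> c" if s: "a < s"
  proof -
    have s0: "0 < s" using a(1) s by simp
    obtain x \<mu> where x: "\<And>n. norm (x n) = 1"
      and lim: "(\<lambda>n. \<bar>\<mu> n\<bar>) \<longlonglongrightarrow> s"
      and lim0: "(\<lambda>n. norm (A (x n) + B (x n) - \<mu> n *\<^sub>R x n)) \<longlonglongrightarrow> 0"
      using s0 unfolding s_def by (rule approximate_eigenvector[OF sS]) blast
    define d where "d = (\<lambda>n. A (x n) + B (x n) - \<mu> n *\<^sub>R x n)"
    have lim_d: "(\<lambda>n. norm (d n)) \<longlonglongrightarrow> 0" using lim0 by (simp add: d_def)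
    have le: "(\<bar>\<mu> n\<bar> - a) * (\<bar>\<mu> n\<bar> - b - norm (d n)) \<le> c + a * norm (d n)" if n: "a < \<bar>\<mu> n\<bar>" for n
    proof -
      define v where "v = norm (A (x n))"
      have "\<bar>\<mu> n\<bar> = norm (\<mu> n *\<^sub>R x n)" by (simp add: x)
      also have "\<dots> = norm (A (x n) + B (x n) - d n)" by (simp add: d_def)
      also have "\<dots> \<le> v + b + norm (d n)"
        using norm_triangle_ineq4[of "A (x n) + B (x n)" "d n"]
          norm_triangle_ineq[of "A (x n)" "B (x n)"] b[of "x n"] x[of n]
        by (simp add: v_def)
      finally have 1: "\<bar>\<mu> n\<bar> - b - norm (d n) \<le> v" by simp
      have "\<bar>\<mu> n\<bar> * v = norm (A (\<mu> n *\<^sub>R x n))" by (simp add: v_def lin)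
      also have "\<dots> = norm (A (A (x n)) + A (B (x n)) - A (d n))"
        by (simp add: d_def lin)
      also have "\<dots> \<le> a * v + c + a * norm (d n)"
        using norm_triangle_ineq4[of "A (A (x n)) + A (B (x n))" "A (d n)"]
          norm_triangle_ineq[of "A (A (x n))" "A (B (x n))"]
          a(2)[of "A (x n)"] a(2)[of "d n"] AB[of "x n"] x[of n]
        by (simp add: v_def)
      finally have 2: "(\<bar>\<mu> n\<bar> - a) * v \<le> c + a * norm (d n)" by (simp add: algebra_simps)
      have "(\<bar>\<mu> n\<bar> - a) * (\<bar>\<mu> n\<bar> - b - norm (d n)) \<le> (\<bar>\<mu> n\<bar> - a) * v"
        using n by (intro mult_left_mono 1) simp
      with 2 show ?thesis by linarith
    qed
    have "(s - a) * (s - b - 0) \<le> c + a * 0"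
    proof (rule tendsto_le)
      show "(\<lambda>n. c + a * norm (d n)) \<longlonglongrightarrow> c + a * 0" by (intro tendsto_intros lim_d)
      show "(\<lambda>n. (\<bar>\<mu> n\<bar> - a) * (\<bar>\<mu> n\<bar> - b - norm (d n))) \<longlonglongrightarrow> (s - a) * (s - b - 0)"
        by (intro tendsto_mult tendsto_diff tendsto_const lim lim_d)
      show "\<forall>\<^sub>F n in sequentially. (\<bar>\<mu> n\<bar> - a) * (\<bar>\<mu> n\<bar> - b - norm (d n)) \<le> c + a * norm (d n)"
        using order_tendstoD(1)[OF lim s] by eventually_elim (rule le)
    qed simp
    then show ?thesis by simp
  qed
  then show ?thesis
    unfolding s_def[symmetric] by (intro norm_sum_bound c) (meson not_less)
qed

subsection \<open>Real parts of rotated operators\<close>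

lemma bounded_clinear_rotate_op: "bounded_clinear A \<Longrightarrow> bounded_clinear (rotate_op \<theta> A)"
  unfolding rotate_op_def by (rule bounded_clinear_scaleC)

lemma symmetric_re_op:
  fixes A :: "'a::chilbert_space \<Rightarrow> 'a"
  assumes "bounded_clinear A"
  shows "symmetric_op (re_op A)"
  unfolding symmetric_op_def re_op_def
  using assms bounded_clinear_cadjoint[OF assms]
  by (auto intro!: bounded_clinear_scaleR bounded_clinear_add
      simp: cinner_simps cadjoint_left[OF assms] simp flip: cadjoint_right[OF assms])

lemma symmetric_re_op_rotate:
  fixes A :: "'a::chilbert_space \<Rightarrow> 'a"
  shows "bounded_clinear A \<Longrightarrow> symmetric_op (re_op (rotate_op \<theta> A))"
  by (intro symmetric_re_op bounded_clinear_rotate_op)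

lemma Re_cinner_re_op:
  fixes A :: "'a::chilbert_space \<Rightarrow> 'a"
  assumes "bounded_clinear A"
  shows "Re (cinner (re_op A x) x) = Re (cinner (A x) x)"
  using Re_cinner_commute[of x "A x"]
  by (simp add: re_op_def cinner_simps cadjoint_left[OF assms])

lemma Re_cinner_re_op_rotate:
  fixes A :: "'a::chilbert_space \<Rightarrow> 'a"
  assumes "bounded_clinear A"
  shows "Re (cinner (re_op (rotate_op \<theta> A) x) x) = Re (cis \<theta> * cinner (A x) x)"
  by (simp add: Re_cinner_re_op[OF bounded_clinear_rotate_op[OF assms]])
     (simp add: rotate_op_def cinner_simps flip: cis_conv_exp)

text \<open>Rotation preserves the modulus of \<open>cinner (A x) x\<close>, and for the symmetric
  real part a bound on the form is a bound on the norm.\<close>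

lemma norm_re_op_rotate_le:
  fixes A :: "'a::chilbert_space \<Rightarrow> 'a"
  assumes A: "bounded_clinear A"
  shows "norm (re_op (rotate_op \<theta> A) x) \<le> numerical_radius A * norm x"
proof (rule symmetric_op_norm_le[OF symmetric_re_op_rotate[OF A]])
  fix x :: 'a
  have "\<bar>Re (cinner (re_op (rotate_op \<theta> A) x) x)\<bar> \<le> cmod (cis \<theta> * cinner (A x) x)"
    unfolding Re_cinner_re_op_rotate[OF A] by (rule abs_Re_le_cmod)
  also have "\<dots> \<le> numerical_radius A * (norm x)\<^sup>2"
    using cmod_cinner_le_numerical_radius[OF A] by (simp add: norm_mult)
  finally show "\<bar>Re (cinner (re_op (rotate_op \<theta> A) x) x)\<bar> \<le> numerical_radius A * (norm x)\<^sup>2" .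
qed

section \<open>The supremum over rotations, and convex combinations of two operators\<close>

definition re_prod_sup :: "('a::chilbert_space \<Rightarrow> 'a) \<Rightarrow> ('a \<Rightarrow> 'a) \<Rightarrow> real" where
  "re_prod_sup A B = (SUP \<theta>::real. onorm (re_op (rotate_op \<theta> A) \<circ> re_op (rotate_op \<theta> B)))"

context
  fixes A B :: "'a::chilbert_space \<Rightarrow> 'a"
  assumes A: "bounded_clinear A" and B: "bounded_clinear B"
begin

lemma bounded_linear_re_prod: "bounded_linear (re_op (rotate_op \<theta> A) \<circ> re_op (rotate_op \<theta> B))"
  using bounded_linear_compose[OF bounded_clinearD(1) bounded_clinearD(1),
      OF symmetric_opD(1)[OF symmetric_re_op_rotate[OF A]] symmetric_opD(1)[OF symmetric_re_op_rotate[OF B]]]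
  by (simp add: comp_def)

text \<open>The bound is uniform in \<theta>, so the supremum is over a set bounded above.\<close>

lemma onorm_re_prod_le:
  "onorm (re_op (rotate_op \<theta> A) \<circ> re_op (rotate_op \<theta> B)) \<le> numerical_radius A * numerical_radius B"
proof (rule onorm_bound)
  show "0 \<le> numerical_radius A * numerical_radius B"
    by (intro mult_nonneg_nonneg numerical_radius_nonneg A B)
  fix x
  have "norm (re_op (rotate_op \<theta> A) (re_op (rotate_op \<theta> B) x))
      \<le> numerical_radius A * norm (re_op (rotate_op \<theta> B) x)"
    by (rule norm_re_op_rotate_le[OF A])
  also have "\<dots> \<le> numerical_radius A * (numerical_radius B * norm x)"
    by (intro mult_left_mono norm_re_op_rotate_le numerical_radius_nonneg A B)
  finally show "norm ((re_op (rotate_op \<theta> A) \<circ> re_op (rotate_op \<theta> B)) x)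
      \<le> numerical_radius A * numerical_radius B * norm x" by (simp add: mult.assoc)
qed

lemma re_prod_sup_le: "re_prod_sup A B \<le> numerical_radius A * numerical_radius B"
  unfolding re_prod_sup_def by (intro cSUP_least onorm_re_prod_le) simp

lemma norm_re_prod_le:
  "norm (re_op (rotate_op \<theta> A) (re_op (rotate_op \<theta> B) x)) \<le> re_prod_sup A B * norm x"
proof -
  let ?f = "re_op (rotate_op \<theta> A) \<circ> re_op (rotate_op \<theta> B)"
  have "norm (?f x) \<le> onorm ?f * norm x" by (rule onorm[OF bounded_linear_re_prod])
  also have "onorm ?f \<le> re_prod_sup A B"
    unfolding re_prod_sup_def
    by (rule cSUP_upper) (auto intro!: bdd_aboveI2 onorm_re_prod_le)
  finally show ?thesis by (simp add: mult_right_mono)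
qed

lemma re_prod_sup_nonneg: "0 \<le> re_prod_sup A B"
proof -
  have "0 \<le> onorm (re_op (rotate_op 0 A) \<circ> re_op (rotate_op 0 B))"
    by (rule onorm_pos_le[OF bounded_linear_re_prod])
  also have "\<dots> \<le> re_prod_sup A B"
    unfolding re_prod_sup_def
    by (rule cSUP_upper) (auto intro!: bdd_aboveI2 onorm_re_prod_le)
  finally show ?thesis .
qed

text \<open>The estimate holds for any two bounded operators; the Duggal transform enters only when
  it is substituted for \<open>B\<close>. The second bound rests on
  \<open>c \<le> a * b\<close>.\<close>

lemma numerical_radius_convex_combination_le:
  assumes l: "0 \<le> l" "l \<le> 1"
  defines "a \<equiv> l * numerical_radius A" and "b \<equiv> (1 - l) * numerical_radius B"
  shows "numerical_radius (\<lambda>x. l *\<^sub>R A x + (1 - l) *\<^sub>R B x)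
      \<le> 1/2 * (a + b) + 1/2 * sqrt ((a - b)\<^sup>2 + 4 * (l - l\<^sup>2) * re_prod_sup A B)"
    and "1/2 * (a + b) + 1/2 * sqrt ((a - b)\<^sup>2 + 4 * (l - l\<^sup>2) * re_prod_sup A B) \<le> a + b"
proof -
  define c where "c = (l - l\<^sup>2) * re_prod_sup A B"
  have ll: "l - l\<^sup>2 = l * (1 - l)" by (simp add: power2_eq_square algebra_simps)
  then have l2: "0 \<le> l - l\<^sup>2" using l by simp
  have c0: "0 \<le> c" unfolding c_def by (intro mult_nonneg_nonneg l2 re_prod_sup_nonneg)
  have a0: "0 \<le> a" and b0: "0 \<le> b"
    using l numerical_radius_nonneg[OF A] numerical_radius_nonneg[OF B] by (auto simp: a_def b_def)
  have 4: "4 * (l - l\<^sup>2) * re_prod_sup A B = 4 * c" by (simp add: c_def)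
  show "numerical_radius (\<lambda>x. l *\<^sub>R A x + (1 - l) *\<^sub>R B x)
      \<le> 1/2 * (a + b) + 1/2 * sqrt ((a - b)\<^sup>2 + 4 * (l - l\<^sup>2) * re_prod_sup A B)" (is "_ \<le> ?r")
  proof (rule numerical_radius_le)
    show "0 \<le> ?r" unfolding 4 using a0 b0 c0 by simp
    fix x :: 'a assume x: "norm x = 1"
    define m where "m = cinner (l *\<^sub>R A x + (1 - l) *\<^sub>R B x) x"
    obtain u where u: "cmod u = 1" "u * m = of_real (cmod m)" using ex_unimodular by blast
    \<comment> \<open>The angle whose rotation makes \<open>m\<close> real and nonnegative, so that
      its modulus is seen by the real parts of the rotated operators.\<close>
    define \<theta> where "\<theta> = Arg u"
    have cis: "cis \<theta> = u" using cis_Arg[of u] u(1) by (cases "u = 0") (auto simp: \<theta>_def sgn_eq)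
    define R S where "R = (\<lambda>x. l *\<^sub>R re_op (rotate_op \<theta> A) x)"
      and "S = (\<lambda>x. (1 - l) *\<^sub>R re_op (rotate_op \<theta> B) x)"
    have R: "symmetric_op R" and S: "symmetric_op S"
      unfolding R_def S_def
      by (intro symmetric_op_scaleR symmetric_re_op_rotate A B)+
    have "cmod m = Re (u * m)" by (simp add: u)
    also have "\<dots> = l * Re (u * cinner (A x) x) + (1 - l) * Re (u * cinner (B x) x)"
      by (simp add: m_def cinner_simps algebra_simps)
    also have "\<dots> = Re (cinner (R x + S x) x)"
      by (simp add: R_def S_def cinner_simps Re_cinner_re_op_rotate A B cis)
    also have "\<dots> \<le> cmod (cinner (R x + S x) x)" by (rule complex_Re_le_cmod)
    also have "\<dots> \<le> numerical_radius (\<lambda>x. R x + S x)"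
      using cmod_cinner_le_numerical_radius[OF symmetric_opD(1)[OF symmetric_op_add[OF R S]], of x] x
      by simp
    also have "\<dots> \<le> ?r"
      unfolding 4
    proof (rule numerical_radius_symmetric_sum_le[OF R S c0 a0])
      fix y
      show "norm (R y) \<le> a * norm y"
        using mult_left_mono[OF norm_re_op_rotate_le[OF A] l(1)] l
        by (simp add: R_def a_def mult.assoc)
      show "norm (S y) \<le> b * norm y"
        using mult_left_mono[OF norm_re_op_rotate_le[OF B], of "1 - l"] l
        by (simp add: S_def b_def mult.assoc)
      have "R (S y) = (l - l\<^sup>2) *\<^sub>R re_op (rotate_op \<theta> A) (re_op (rotate_op \<theta> B) y)"
        unfolding R_def S_def ll
        by (simp add: bounded_clinearD(5)[OF symmetric_opD(1)[OF symmetric_re_op_rotate[OF A]]])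
      then have "norm (R (S y)) = (l - l\<^sup>2) * norm (re_op (rotate_op \<theta> A) (re_op (rotate_op \<theta> B) y))"
        using l2 by simp
      also have "\<dots> \<le> (l - l\<^sup>2) * (re_prod_sup A B * norm y)"
        by (intro mult_left_mono norm_re_prod_le l2)
      finally show "norm (R (S y)) \<le> c * norm y" by (simp add: c_def mult.assoc)
    qed
    finally show "cmod (cinner (l *\<^sub>R A x + (1 - l) *\<^sub>R B x) x) \<le> ?r" by (simp only: m_def)
  qed
  have "c \<le> (l - l\<^sup>2) * (numerical_radius A * numerical_radius B)"
    unfolding c_def by (intro mult_left_mono re_prod_sup_le l2)
  also have "\<dots> = a * b" by (simp add: ll a_def b_def)
  \<comment> \<open>Replacing \<open>c\<close> by \<open>a * b\<close> completes the square
    \<open>(a + b)\<^sup>2\<close>.\<close>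
  finally have "(a - b)\<^sup>2 + 4 * c \<le> (a + b)\<^sup>2" by (simp add: power2_eq_square algebra_simps)
  then have "sqrt ((a - b)\<^sup>2 + 4 * c) \<le> a + b" using a0 b0 by (intro real_le_lsqrt) auto
  then show "1/2 * (a + b) + 1/2 * sqrt ((a - b)\<^sup>2 + 4 * (l - l\<^sup>2) * re_prod_sup A B) \<le> a + b"
    unfolding 4 by argo
qed

end

section \<open>Mean transforms\<close>

theorem theorem4p7:
  fixes T :: "'a::chilbert_space \<Rightarrow> 'a" and l :: real
  assumes "bounded_clinear T" and "0 \<le> l" and "l \<le> 1"
  shows "numerical_radius (lambda_mean l T)
      \<le> 1/2 * (l * numerical_radius T + (1 - l) * numerical_radius (duggal T))
        + 1/2 * sqrt ((l * numerical_radius T - (1 - l) * numerical_radius (duggal T))^2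
            + 4 * (l - l^2) * (SUP \<theta>::real. onorm (re_op (rotate_op \<theta> T) \<circ> re_op (rotate_op \<theta> (duggal T)))))
      \<and> 1/2 * (l * numerical_radius T + (1 - l) * numerical_radius (duggal T))
        + 1/2 * sqrt ((l * numerical_radius T - (1 - l) * numerical_radius (duggal T))^2
            + 4 * (l - l^2) * (SUP \<theta>::real. onorm (re_op (rotate_op \<theta> T) \<circ> re_op (rotate_op \<theta> (duggal T)))))
      \<le> l * numerical_radius T + (1 - l) * numerical_radius (duggal T)
      \<and> numerical_radius (mean_transform T)
      \<le> (numerical_radius T + numerical_radius (duggal T)
          + sqrt ((numerical_radius T - numerical_radius (duggal T))^2
            + 4 * (SUP \<theta>::real. onorm (re_op (rotate_op \<theta> T) \<circ> re_op (rotate_op \<theta> (duggal T)))))) / 4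
      \<and> (numerical_radius T + numerical_radius (duggal T)
          + sqrt ((numerical_radius T - numerical_radius (duggal T))^2
            + 4 * (SUP \<theta>::real. onorm (re_op (rotate_op \<theta> T) \<circ> re_op (rotate_op \<theta> (duggal T)))))) / 4
      \<le> numerical_radius T"
proof -
  note T = assms(1) and D = bounded_clinear_duggal[OF assms(1)]
  define t d r where "t = numerical_radius T" and "d = numerical_radius (duggal T)"
    and "r = re_prod_sup T (duggal T)"
  note bounds = numerical_radius_convex_combination_le[OF T D, folded t_def d_def r_def]
  \<comment> \<open>At \<open>l = 1/2\<close> the factor \<open>4 * (l - l\<^sup>2)\<close> equals
    1, and a factor 1/4 leaves the root as 1/2.\<close>
  have half: "1/2 * (1/2 * t + (1 - 1/2) * d)
      + 1/2 * sqrt ((1/2 * t - (1 - 1/2) * d)\<^sup>2 + 4 * (1/2 - (1/2)\<^sup>2) * r)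
    = (t + d + sqrt ((t - d)\<^sup>2 + 4 * r)) / 4"
  proof -
    have "(1/2 * t - (1 - 1/2) * d)\<^sup>2 + 4 * (1/2 - (1/2)\<^sup>2) * r = ((t - d)\<^sup>2 + 4 * r) / 2\<^sup>2"
      by (simp add: power2_eq_square field_simps)
    then have "sqrt ((1/2 * t - (1 - 1/2) * d)\<^sup>2 + 4 * (1/2 - (1/2)\<^sup>2) * r) = sqrt ((t - d)\<^sup>2 + 4 * r) / 2"
      by (simp only: real_sqrt_divide real_sqrt_abs abs_numeral)
    then show ?thesis by argo
  qed
  have "(t + d + sqrt ((t - d)\<^sup>2 + 4 * r)) / 4 \<le> 1/2 * t + (1 - 1/2) * d"
    using bounds(2)[of "1/2"] unfolding half by simp
  \<comment> \<open>The average of \<open>t\<close> and \<open>d\<close> is at most \<open>t\<close>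
    because the Duggal transform does not increase the numerical radius.\<close>
  also have "\<dots> \<le> t"
    using numerical_radius_duggal_le[OF T] by (simp add: t_def d_def)
  finally have "(t + d + sqrt ((t - d)\<^sup>2 + 4 * r)) / 4 \<le> t" .
  moreover have "numerical_radius (mean_transform T) \<le> (t + d + sqrt ((t - d)\<^sup>2 + 4 * r)) / 4"
    using bounds(1)[of "1/2"] unfolding half by (simp add: mean_transform_def lambda_mean_def)
  ultimately show ?thesis
    using bounds[OF assms(2,3)]
    unfolding lambda_mean_def re_prod_sup_def[symmetric] t_def[symmetric] d_def[symmetric] r_def[symmetric]
    by blast
qed

end
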